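(* Let $c_1>0$ and let $M,K:\mathbb{R}_+\to[2,\infty)$ be continuous and increasing functions satisfying, for some increasing function $N:\mathbb{R}_+\to[1,\infty)$, (i) $\lim_{s\to\infty}\frac{M_K(s)}{\log(2+s)}=\infty$, and there exist $\varepsilon>0$, $s_0>0$ such that $K(s)\ge s^{\varepsilon}$ for all $s\ge s_0$; (ii) there exists $s_0>0$ such that for all $s\ge s_0$ and $s'\ge0$: $M(s+s')\le N(s')M(s)$. Then there exist a real number $\gamma\ge0$, not depending on $c_1$, and a locally integrable function $f:\mathbb{R}_+\to\mathbb{C}$ with $f'\in L^\infty(\mathbb{R}_+)$, whose Laplace transform $\hat f$ extends analytically to $\Omega_M\cup\mathbb{C}_+$, and a constant $C>0$, such that $$|\hat f(z)|\le C\,M(|\operatorname{Im}z|)^{\frac12}K(|\operatorname{Im}z|)^{\frac{\gamma}{c_1}}\quad\text{for all } z\in\Omega_M\qquad(\ast)$$ and $$\limsup_{t\to\infty}M_K^{-1}(c_1t)\,|f(t)|>0.\qquad(\ast\ast)$$ If instead of (ii) we have the stronger assumption that there exists $\gamma_0\ge1$ such that (ii') for all $s_1>0$ there is $s_0>0$ such that for all $s\ge s_0$ and $0\le s'\le s_1$: $M(s+s')\le\gamma_0M(s)$, and if $\gamma>\gamma_0$, then it is possible to choose $f$ in such a way that $(\ast)$ holds for this choice of $\gamma$ (together with the other properties, in particular $(\ast\ast)$). If in addition $M$ is unbounded, then it is possible to choose $f$ in such a way that $(\ast)$ holds for all $\gamma>\gamma_0$ (with $C$ possibly depending on $\gamm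a$).
   Context: $\mathbb{R}_+=[0,\infty)$ and $\mathbb{C}_+=\{z\in\mathbb{C}:\operatorname{Re}z\ge0\}$. "Increasing" is meant in the non-strict sense. $f'$ is the weak derivative. The Laplace transform is $\hat f(z)=\int_0^\infty e^{-zt}f(t)\,dt$ for $\operatorname{Re}z>0$. $$\Omega_M=\left\{z\in\mathbb{C}:\ 0>\operatorname{Re}z>-\frac{1}{M(|\operatorname{Im}z|)}\right\}.$$ $M_K(s)=M(s)\log(K(s))$, and $M_K^{-1}(t)=\sup\{s\ge0:M_K(s)=t\}$ (defined for all sufficiently large $t$) is the right-continuous right-inverse of $M_K$. *)

theory Defs
  imports "HOL-Analysis.Analysis"
begin

text \<open>Functions on \<open>[0,\<infinity>)\<close> are total functions on \<^typ>\<open>real\<close> of which only the values on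
  \<^term>\<open>{0::real..}\<close> are used.\<close>

definition M_log :: "(real \<Rightarrow> real) \<Rightarrow> (real \<Rightarrow> real) \<Rightarrow> real \<Rightarrow> real" where
  "M_log M K s = M s * ln (K s)"

text \<open>For small \<open>t\<close> the set below may be empty, and then the value is unspecified; only large
  \<open>t\<close> matter. There the set is nonempty and bounded as soon as \<open>M_log M K\<close> is continuous
  and tends to infinity.\<close>

definition M_log_inv :: "(real \<Rightarrow> real) \<Rightarrow> (real \<Rightarrow> real) \<Rightarrow> real \<Rightarrow> real" where
  "M_log_inv M K t = Sup {s. 0 \<le> s \<and> M_log M K s = t}"

definition Omega :: "(real \<Rightarrow> real) \<Rightarrow> complex set" where
  "Omega M = {z. 0 > Re z \<and> Re z > - (1 / M \<bar>Im z\<bar>)}"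

definition closed_right_half_plane :: "complex set" where
  "closed_right_half_plane = {z. 0 \<le> Re z}"

definition locally_integrable :: "(real \<Rightarrow> complex) \<Rightarrow> bool" where
  "locally_integrable f \<longleftrightarrow> (\<forall>T\<ge>0. set_integrable lborel {0..T} f)"

definition test_function :: "(real \<Rightarrow> real) \<Rightarrow> bool" where
  "test_function \<phi> \<longleftrightarrow>
     (\<forall>n t. (deriv ^^ n) \<phi> field_differentiable at t) \<and>
     (\<exists>a>0. \<exists>b. \<forall>t. \<phi> t \<noteq> 0 \<longrightarrow> t \<in> {a..b})"

definition has_weak_derivative :: "(real \<Rightarrow> complex) \<Rightarrow> (real \<Rightarrow> complex) \<Rightarrow> bool" where
  "has_weak_derivative f g \<longleftrightarrow>
     (\<forall>\<phi>. test_function \<phi> \<longrightarrow>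
        (LBINT t:{0<..}. complex_of_real (deriv \<phi> t) * f t) =
        - (LBINT t:{0<..}. complex_of_real (\<phi> t) * g t))"

definition L_infinity :: "(real \<Rightarrow> complex) \<Rightarrow> bool" where
  "L_infinity g \<longleftrightarrow>
     set_borel_measurable lborel {0..} g \<and>
     (\<exists>B. AE t in lborel. 0 \<le> t \<longrightarrow> cmod (g t) \<le> B)"

definition laplace_transform :: "(real \<Rightarrow> complex) \<Rightarrow> complex \<Rightarrow> complex" where
  "laplace_transform f z = (LBINT t:{0..}. exp (- z * complex_of_real t) * f t)"

text \<open>The function \<open>F\<close> is the analytic extension of the Laplace transform of \<open>f\<close>. A locally
  integrable \<open>f\<close> with weak derivative in \<open>L\<^sup>\<infinity>\<close> agrees almost everywhere with a unique continuous
  (even Lipschitz) function. Continuity is demanded here to select that representative: otherwise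
  the pointwise limit superior could be made positive by altering \<open>f\<close> on a null set.\<close>

definition extremal_function ::
  "(real \<Rightarrow> real) \<Rightarrow> (real \<Rightarrow> real) \<Rightarrow> real \<Rightarrow> (real \<Rightarrow> complex) \<Rightarrow> (complex \<Rightarrow> complex) \<Rightarrow> bool" where
  "extremal_function M K c f F \<longleftrightarrow>
     locally_integrable f \<and>
     continuous_on {0..} f \<and>
     (\<exists>g. has_weak_derivative f g \<and> L_infinity g) \<and>
     F analytic_on (Omega M \<union> closed_right_half_plane) \<and>
     (\<forall>z. 0 < Re z \<longrightarrow> F z = laplace_transform f z) \<and>
     Limsup at_top (\<lambda>t. ereal (M_log_inv M K (c * t) * cmod (f t))) > 0"

end

theory Submission
  imports Defs "HOL-Complex_Analysis.Complex_Analysis" "HOL-Real_Asymp.Real_Asymp"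
begin

text \<open>
  The extremal function is a sparse train of pulses. A pulse with peak time \<open>p\<close>, decay rate \<open>a\<close>,
  degree \<open>n = a * p\<close> and frequency \<open>\<sigma>\<close> is
  \<open>(1 / s) * (t / p) ^ n * exp (n - a * t) * exp (\<i> * \<sigma> * t)\<close>. Its modulus is \<open>(u * exp (1 - u)) ^ n / s\<close>
  with \<open>u = t / p\<close>, which equals \<open>1 / s\<close> at the peak and decays exponentially in \<open>n\<close> away from it. Its Laplace
  transform is a constant times \<open>1 / (z + a - \<i> * \<sigma>) ^ (n + 1)\<close>. The only singularity is a pole with real
  part \<open>- a\<close>, which lies to the left of \<open>Omega M\<close> for \<open>a \<ge> 1\<close>, so that all terms are analytic in one
  half-plane (\<open>train_laplace_analytic\<close>).

  The height \<open>1 / s\<close> and the peak time are tied together by \<open>M_log M K s = c * p\<close>. Then the weight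
  \<open>M_log_inv M K (c * p)\<close> is at least \<open>s\<close>, and the weighted pulse has size at least \<open>1\<close> at its peak. The
  derivative of a pulse is of size \<open>\<sigma> / s\<close>, which stays bounded for \<open>\<sigma>\<close> comparable with \<open>s\<close>.

  For the growth bound let \<open>\<sigma> = s + 2 * a\<close>. By Stirling's formula the transform of the pulse is at most a
  constant times \<open>(sqrt n / s) * (a / r) ^ n / r\<close>, where \<open>r\<close> is the distance from \<open>z\<close> to the pole. If the
  imaginary part of \<open>z\<close> differs from \<open>\<sigma>\<close> by \<open>2 * a\<close> or more, then \<open>a / r \<le> 1 / 2\<close>, and the pulse contributes at most
  a multiple of \<open>1 / s\<close> (\<open>norm_pulse_laplace_off_peak\<close>). Otherwise the imaginary part is above \<open>s\<close>; so in
  \<open>Omega M\<close> the real part is above \<open>- 1 / M s\<close>, and \<open>(a / r) ^ n\<close> is at most \<open>exp (n / (a * M s - 1))\<close>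
  (\<open>norm_pulse_laplace_near_peak\<close>). By the choice of \<open>p\<close> this is at most \<open>K s powr (\<theta> / c)\<close> with
  \<open>\<theta> = 2 * a / (2 * a - 1)\<close>. The square root of \<open>p = M s * ln (K s) / c\<close> gives the factor
  \<open>M powr (1/2)\<close>, and the remaining \<open>sqrt (ln (K s))\<close> is absorbed by an arbitrarily small power of \<open>K s\<close>.
  Since \<open>M\<close> and \<open>K\<close> increase, \<open>s\<close> may be replaced by the imaginary part of \<open>z\<close>. If the rate \<open>a\<close> of the \<open>k\<close>-th
  pulse tends to infinity with \<open>k\<close>, then \<open>\<theta>\<close> tends to \<open>1\<close>, and the one function so obtained satisfies the bound for every
  \<open>\<gamma> > 1\<close> (\<open>norm_train_laplace_le\<close>). All parts of the theorem follow: for the first, \<open>\<gamma> = 2\<close> serves all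
  \<open>c\<close>, and in the others \<open>\<gamma> > \<gamma>0 \<ge> 1\<close>.

  It remains to keep the pulses from interfering (\<open>exists_pulse_train\<close>). Because \<open>M_log M K\<close> dominates the logarithm, \<open>s\<close> is
  subexponential in \<open>p\<close>. So if each peak time is chosen late enough, the earlier pulses have decayed far below \<open>1 / s\<close>
  when a new one peaks, while the later pulses are smaller than \<open>1 / s\<close> throughout, by their small heights.
\<close>

section \<open>Elementary estimates for the profile of a pulse\<close>

text \<open>The \<open>n\<close>-th power is the density of a Gamma distribution, rescaled so that its maximum is \<open>1\<close>,
  attained at \<open>u = 1\<close>; stretched in time, it is the envelope of the pulses below.\<close>

definition bump :: "real \<Rightarrow> real" where
  "bump u = u * exp (1 - u)"

lemma bump_nonneg: "0 \<le> u \<Longrightarrow> 0 \<le> bump u"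
  by (simp add: bump_def)

lemma bump_le_1: "bump u \<le> 1"
proof -
  have "u * exp (1 - u) \<le> exp (u - 1) * exp (1 - u)"
    using exp_ge_add_one_self[of "u - 1"] by (intro mult_right_mono) auto
  also have "\<dots> = 1"
    by (simp flip: exp_add)
  finally show ?thesis
    by (simp add: bump_def)
qed

text \<open>By a factor \<open>2\<close> away from the peak the profile is at most \<open>max (sqrt e / 2) (2 / e)\<close>, so its powers
  decay geometrically. The proof multiplies the convexity inequality \<open>1 + v \<le> exp v\<close>, applied to
  \<open>v = 2 * u - 1\<close> and \<open>v = u - 2\<close>, with \<open>exp (1 - u)\<close>.\<close>

lemma bump_far:
  assumes "0 \<le> u" "2 * u \<le> 1 \<or> 2 \<le> u"
  shows "bump u \<le> 5 / 6"
  using assms(2)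
proof
  assume u: "2 * u \<le> 1"
  have sqrt_e: "exp (1 / 2 :: real) \<le> 5 / 3"
  proof -
    have "exp (1 / 2 :: real) ^ 2 = exp 1"
      by (simp flip: exp_of_nat_mult)
    also have "\<dots> \<le> (5 / 3) ^ 2"
      using e_less_272 by (simp add: power2_eq_square)
    finally show ?thesis
      by (rule power2_le_imp_le) auto
  qed
  have "2 * u \<le> exp (2 * u - 1)"
    using exp_ge_add_one_self[of "2 * u - 1"] by simp
  also have "\<dots> \<le> exp (u - 1 / 2)"
    using u by simp
  finally have "u * exp (1 - u) \<le> (exp (u - 1 / 2) / 2) * exp (1 - u)"
    by (intro mult_right_mono) auto
  also have "\<dots> = exp (1 / 2) / 2"
    by (simp flip: exp_add)
  also have "\<dots> \<le> 5 / 6"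
    using sqrt_e by simp
  finally show ?thesis
    by (simp add: bump_def)
next
  assume u: "2 \<le> u"
  have "u \<le> 2 * exp (u - 2)"
    using exp_ge_add_one_self[of "u - 2"] u by simp
  hence "u * exp (1 - u) \<le> (2 * exp (u - 2)) * exp (1 - u)"
    by (intro mult_right_mono) auto
  also have "\<dots> = 2 * exp (-1)"
    by (simp flip: exp_add)
  also have "\<dots> \<le> 5 / 6"
  proof -
    have "12 / 5 \<le> exp (1 :: real)"
      using exp_lower_Taylor_quadratic[of "1::real"] by simp
    thus ?thesis
      by (simp add: exp_minus field_simps)
  qed
  finally show ?thesis
    by (simp add: bump_def)
qed

text \<open>The upper half of Stirling's formula. The quotient of the two sides decreases in \<open>n\<close> because
  \<open>(n + 1/2) * ln (1 + 1/n) \<ge> 1\<close>. The factor \<open>sqrt n\<close> must not be lost: it is what finally becomes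
  \<open>M powr (1/2)\<close>.\<close>

lemma fact_le_sqrt_mult_exp:
  assumes "0 < n"
  shows "fact n \<le> exp 1 * sqrt n * (real n / exp 1) ^ n"
  using assms
proof (induction n rule: nat_induct_non_zero)
  case 1
  show ?case by simp
next
  case (Suc n)
  define x where "x = real n"
  have x: "x > 0"
    using Suc by (simp add: x_def)
  have "1 \<le> (x + 1 / 2) * (ln (x + 1) - ln x)"
    using ln_inverse_approx_ge[of x "x + 1"] x by (simp add: field_simps)
  hence "exp 1 \<le> exp ((x + 1 / 2) * (ln (x + 1) - ln x))"
    by simp
  also have "\<dots> = ((x + 1) / x) powr (x + 1 / 2)"
    using x by (simp add: powr_def ln_div)
  also have "\<dots> = ((x + 1) / x) ^ n * (sqrt (x + 1) / sqrt x)"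
    using x by (simp add: powr_add x_def powr_realpow powr_half_sqrt real_sqrt_divide)
  finally have key: "exp 1 \<le> ((x + 1) / x) ^ n * (sqrt (x + 1) / sqrt x)" .
  have "fact (Suc n) = (x + 1) * fact n"
    by (simp add: x_def)
  also have "\<dots> \<le> (x + 1) * (exp 1 * sqrt x * (x / exp 1) ^ n)"
    using Suc x by (intro mult_left_mono) (auto simp: x_def)
  also have "\<dots> = ((x + 1) * sqrt x * (x / exp 1) ^ n) * exp 1"
    by simp
  also have "\<dots> \<le> ((x + 1) * sqrt x * (x / exp 1) ^ n) * (((x + 1) / x) ^ n * (sqrt (x + 1) / sqrt x))"
    using x by (intro mult_left_mono key) auto
  also have "\<dots> = (x + 1) * sqrt (x + 1) * ((x + 1) / exp 1) ^ n"
    using x by (simp add: field_simps)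
  also have "\<dots> = exp 1 * sqrt (real (Suc n)) * (real (Suc n) / exp 1) ^ Suc n"
    by (simp add: x_def add.commute)
  finally show ?case .
qed

lemma bump_power:
  assumes "0 < n"
  shows "bump (c * t / real n) ^ n = (c * exp 1 / n) ^ n * (t ^ n * exp (- c * t))"
proof -
  have "exp (- c * t) = exp (- (c * t / n)) ^ n"
    using assms by (simp flip: exp_of_nat_mult)
  hence "(c * exp 1 / n) ^ n * (t ^ n * exp (- c * t)) = (c * exp 1 / n * (t * exp (- (c * t / n)))) ^ n"
    by (simp only: power_mult_distrib)
  also have "c * exp 1 / n * (t * exp (- (c * t / n))) = (c * t / n) * (exp 1 * exp (- (c * t / n)))"
    by simp
  also have "\<dots> = bump (c * t / n)"
    by (simp add: bump_def flip: exp_add)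
  finally show ?thesis ..
qed

text \<open>The derivative of a power of the profile produces a factor \<open>t ^ (n - 1)\<close> in place of \<open>t ^ n\<close>; it is
  again controlled by a power of the profile, with exponent lowered by one.\<close>

lemma bump_power_pred:
  assumes "0 < n"
  shows "c * exp (1 - c * t / real n) * bump (c * t / n) ^ (n - 1) =
         (c * exp 1 / n) ^ n * (n * t ^ (n - 1) * exp (- c * t))"
proof -
  obtain m where m: "n = Suc m"
    using assms gr0_conv_Suc by auto
  hence m': "n - 1 = m"
    by simp
  have "exp (1 - c * t / n) ^ n = exp 1 ^ n * exp (- c * t)"
    using assms by (simp add: right_diff_distrib flip: exp_of_nat_mult exp_add)
  hence E: "exp (1 - c * t / n) * exp (1 - c * t / n) ^ m = exp 1 ^ n * exp (- c * t)"
    by (simp add: m)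
  have "c * x * (u * x) ^ m = c * u ^ m * (x * x ^ m)" for u x :: real
    by (simp add: power_mult_distrib)
  hence "c * exp (1 - c * t / n) * bump (c * t / n) ^ (n - 1) = c * (c * t / n) ^ m * (exp 1 ^ n * exp (- c * t))"
    by (simp only: bump_def E m')
  also have "\<dots> = (c * exp 1 / n) ^ n * (n * t ^ (n - 1) * exp (- c * t))"
    by (simp add: m power_mult_distrib power_divide)
  finally show ?thesis .
qed

lemma power_mult_exp_bounded:
  assumes "0 < (c :: real)"
  obtains C where "\<And>t. 0 \<le> t \<Longrightarrow> t ^ n * exp (- c * t) \<le> C"
proof (cases "n = 0")
  case True
  thus ?thesis
    using assms that[of 1] by simp
next
  case False
  have "t ^ n * exp (- c * t) \<le> 1 / (c * exp 1 / n) ^ n" if "0 \<le> t" for t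
  proof -
    have "(c * exp 1 / n) ^ n * (t ^ n * exp (- c * t)) \<le> 1"
      using False assms that
      by (subst bump_power[symmetric]) (auto intro!: power_le_one bump_nonneg bump_le_1)
    thus ?thesis
      using False assms by (simp add: pos_le_divide_eq mult.commute)
  qed
  thus ?thesis by (rule that)
qed

text \<open>Exponents \<open>\<theta> k\<close> that tend to \<open>1\<close> are eventually below \<open>\<gamma>\<close> by a fixed margin \<open>\<delta>\<close>, and then
  \<open>exp (\<delta> * x)\<close> absorbs the square root. The finitely many earlier indices only enlarge the constant.\<close>

lemma sqrt_mult_exp_sequence_bounded:
  fixes x \<theta> :: "nat \<Rightarrow> real"
  assumes x: "\<And>k. 0 \<le> x k" and \<theta>: "\<theta> \<longlonglongrightarrow> 1" and \<gamma>: "1 < \<gamma>"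
  obtains B where "0 \<le> B" "\<And>k. sqrt (x k) * exp (\<theta> k * x k) \<le> B * exp (\<gamma> * x k)"
proof -
  \<comment> \<open>half of the gap absorbs the square root, the other half the convergence of \<open>\<theta>\<close>\<close>
  define \<delta> where "\<delta> = (\<gamma> - 1) / 2"
  have \<delta>: "0 < \<delta>"
    using \<gamma> by (simp add: \<delta>_def)
  have "\<forall>\<^sub>F k in sequentially. \<theta> k < \<gamma> - \<delta>"
    using \<gamma> by (intro order_tendstoD[OF \<theta>]) (simp add: \<delta>_def field_simps)
  then obtain k0 where k0: "\<And>k. k0 \<le> k \<Longrightarrow> \<theta> k < \<gamma> - \<delta>"
    by (auto simp: eventually_sequentially)
  define B where "B = 1 + 1 / \<delta> + (\<Sum>k<k0. sqrt (x k) * exp (\<theta> k * x k))"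
  have pos: "0 \<le> sqrt (x k) * exp (\<theta> k * x k)" for k
    using x by simp
  have sum_pos: "0 \<le> (\<Sum>k<k0. sqrt (x k) * exp (\<theta> k * x k))"
    using pos by (intro sum_nonneg)
  show ?thesis
  proof (rule that[of B])
    show "0 \<le> B"
      using sum_pos \<delta> by (simp add: B_def)
    show "sqrt (x k) * exp (\<theta> k * x k) \<le> B * exp (\<gamma> * x k)" for k
    proof (cases "k < k0")
      case True
      have "sqrt (x k) * exp (\<theta> k * x k) \<le> (\<Sum>k<k0. sqrt (x k) * exp (\<theta> k * x k))"
        using True pos by (intro member_le_sum) auto
      also have "\<dots> \<le> B * 1"
        using \<delta> by (simp add: B_def)
      also have "\<dots> \<le> B * exp (\<gamma> * x k)"
        using x \<gamma> \<open>0 \<le> B\<close> by (intro mult_left_mono) auto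
      finally show ?thesis .
    next
      case False
      have "sqrt (x k) \<le> 1 + x k"
        using x[of k] by (intro real_le_lsqrt) (auto simp: power2_eq_square algebra_simps)
      also have "\<dots> \<le> exp (\<delta> * x k) + 1 / \<delta> * exp (\<delta> * x k)"
      proof (rule add_mono)
        have "\<delta> * x k \<le> exp (\<delta> * x k)"
          using exp_ge_add_one_self[of "\<delta> * x k"] by linarith
        thus "x k \<le> 1 / \<delta> * exp (\<delta> * x k)"
          using \<delta> by (simp add: field_simps)
      qed (use x[of k] \<delta> in simp)
      also have "\<dots> \<le> B * exp (\<delta> * x k)"
        using sum_pos by (simp add: B_def algebra_simps)
      finally have "sqrt (x k) * exp (\<theta> k * x k) \<le> B * exp (\<delta> * x k) * exp ((\<gamma> - \<delta>) * x k)"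
        using k0[of k] False x[of k] \<open>0 \<le> B\<close>
        by (intro mult_mono) (auto intro!: mult_right_mono)
      also have "\<dots> = B * exp (\<gamma> * x k)"
        by (simp add: ring_distribs flip: exp_add)
      finally show ?thesis .
    qed
  qed
qed

section \<open>Integrals over the half-line\<close>

lemma set_integrable_exp_decay:
  assumes "0 < (x :: real)"
  shows "set_integrable lborel {0..} (\<lambda>t. exp (- x * t))"
proof -
  have "(\<lambda>t. exp (- x * t)) absolutely_integrable_on {0..}"
    using assms
    by (intro nonnegative_absolutely_integrable_1 integrable_on_exp_minus_to_infinity) auto
  thus ?thesis
    unfolding set_integrable_def
    by (subst (asm) integrable_completion) auto
qed

lemma has_vector_derivative_power_mult_exp:
  fixes b :: complex
  shows "((\<lambda>t. of_real t ^ n * exp (- b * of_real t)) has_vector_derivative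
     (of_nat n * of_real t ^ (n - 1) - b * of_real t ^ n) * exp (- b * of_real t)) (at t within S)"
proof -
  have "((\<lambda>w. w ^ n * exp (- b * w)) has_field_derivative
     (of_nat n * of_real t ^ (n - 1) - b * of_real t ^ n) * exp (- b * of_real t)) (at (of_real t))"
    by (auto intro!: derivative_eq_intros simp: algebra_simps)
  from field_vector_diff_chain_within[OF has_vector_derivative_of_real[OF DERIV_ident] 
      has_field_derivative_at_within[OF this]]
  show ?thesis
    by (simp add: o_def id_def)
qed

text \<open>With a complex rate, so that shifting the Laplace variable and modulating the function are covered by
  one formula.\<close>

lemma laplace_monomial:
  fixes b :: complex
  assumes b: "0 < Re b"
  shows "set_integrable lborel {0..} (\<lambda>t. of_real t ^ n * exp (- b * of_real t))"
    and "(LBINT t:{0..}. of_real t ^ n * exp (- b * of_real t)) = fact n / b ^ (n + 1)"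
proof -
  let ?g = "\<lambda>n t. of_real t ^ n * exp (- b * of_real t) :: complex"
  have int: "set_integrable lborel {0..} (?g n)" for n
  proof -
    obtain C where C: "\<And>t. 0 \<le> t \<Longrightarrow> t ^ n * exp (- (Re b / 2) * t) \<le> C"
      using power_mult_exp_bounded[of "Re b / 2" n] b by auto
    have 1: "set_integrable lborel {0..} (\<lambda>t. C * exp (- (Re b / 2) * t))"
      using b by (intro set_integrable_mult_right set_integrable_exp_decay) auto
    show ?thesis
    proof (rule set_integrable_bound[OF 1])
      show "set_borel_measurable lborel {0..} (?g n)"
        unfolding set_borel_measurable_def by measurable
      show "AE t in lborel. t \<in> {0..} \<longrightarrow> norm (?g n t) \<le> norm (C * exp (- (Re b / 2) * t))"
      proof (intro AE_I2 impI)
        fix t :: real assume t: "t \<in> {0..}"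
        have "norm (?g n t) = (t ^ n * exp (- (Re b / 2) * t)) * exp (- (Re b / 2) * t)"
          using t by (simp add: norm_mult norm_power flip: exp_add)
        also have "\<dots> \<le> C * exp (- (Re b / 2) * t)"
          using C[of t] t by (intro mult_right_mono) auto
        also have "\<dots> \<le> norm \<dots>"
          by simp
        finally show "norm (?g n t) \<le> norm (C * exp (- (Re b / 2) * t))" .
      qed
    qed
  qed
  show "set_integrable lborel {0..} (?g n)"
    by (rule int)
  have b0: "b \<noteq> 0" using b by auto
  \<comment> \<open>integration by parts, in the form of an antiderivative vanishing at infinity\<close>
  define P where "P = rec_nat (\<lambda>t. - ?g 0 t / b)
    (\<lambda>n p t. - ?g (Suc n) t / b + of_nat (Suc n) / b * p t)"
  have P0: "P 0 t = - ?g 0 t / b" and PS: "P (Suc n) t = - ?g (Suc n) t / b + of_nat (Suc n) / b * P n t"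
    for n t by (simp_all add: P_def)
  have deriv: "(P n has_vector_derivative ?g n t) (at t)" for n t
  proof (induction n)
    case 0
    have "(P 0 has_vector_derivative - ((of_nat 0 * of_real t ^ (0 - 1) - b * of_real t ^ 0) * exp (- b * of_real t)) / b) (at t)"
      unfolding P0[abs_def]
      by (intro has_vector_derivative_divide has_vector_derivative_minus has_vector_derivative_power_mult_exp)
    thus ?case
      using b0 by simp
  next
    case (Suc n)
    have "(P (Suc n) has_vector_derivative
        - ((of_nat (Suc n) * of_real t ^ (Suc n - 1) - b * of_real t ^ Suc n) * exp (- b * of_real t)) / b
        + of_nat (Suc n) / b * (of_real t ^ n * exp (- b * of_real t))) (at t)"
      unfolding PS[abs_def]
      by (intro has_vector_derivative_add has_vector_derivative_divide has_vector_derivative_minus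
          has_vector_derivative_mult_right has_vector_derivative_power_mult_exp Suc)
    thus ?case
      using b0 by (simp add: field_simps)
  qed
  have g_lim: "(?g n \<longlongrightarrow> 0) at_top" for n
  proof -
    have "((\<lambda>t::real. t ^ n * exp (- Re b * t)) \<longlongrightarrow> 0) at_top"
      using b by real_asymp
    moreover have "\<forall>\<^sub>F t in at_top. norm (?g n t) \<le> t ^ n * exp (- Re b * t)"
      using eventually_ge_at_top[of 0] by eventually_elim (simp add: norm_mult norm_power)
    ultimately show ?thesis
      by (rule Lim_null_comparison[rotated])
  qed
  have P_lim: "(P n \<longlongrightarrow> 0) at_top" for n
  proof (induction n)
    case 0
    show ?case
      unfolding P0[abs_def] using tendsto_divide[OF tendsto_minus[OF g_lim[of 0]] tendsto_const b0] by simp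
  next
    case (Suc n)
    show ?case
      unfolding PS[abs_def] 
      using tendsto_add[OF tendsto_divide[OF tendsto_minus[OF g_lim[of "Suc n"]] tendsto_const b0] 
         tendsto_mult[OF tendsto_const[of "of_nat (Suc n) / b"] Suc]] by simp
  qed
  have P_0: "P n 0 = - fact n / b ^ (n + 1)" for n
  proof (induction n)
    case (Suc n)
    have "P (Suc n) 0 = of_nat (Suc n) / b * (- fact n / b ^ (n + 1))"
      by (simp only: PS Suc) simp
    thus ?case
      by simp
  qed (simp add: P0)
  have "(LBINT x=ereal 0..\<infinity>. ?g n x) = 0 - (- fact n / b ^ (n + 1))"
  proof (rule interval_integral_FTC_integrable)
    show "(P n has_vector_derivative ?g n x) (at x)" for x
      by (rule deriv)
    show "isCont (?g n) x" for x
      by (intro continuous_intros)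
    have "set_integrable lborel {0<..} (?g n)"
      by (rule set_integrable_subset[OF int]) auto
    thus "set_integrable lborel (einterval (ereal 0) \<infinity>) (?g n)"
      by (simp add: einterval_eq_Ici)
    have "isCont (P n) 0"
      using deriv[of n 0] by (rule has_vector_derivative_continuous)
    hence "(P n \<longlongrightarrow> P n 0) (at_right 0)"
      by (auto simp: isCont_def intro: tendsto_mono[OF at_le])
    thus "((P n \<circ> real_of_ereal) \<longlongrightarrow> - fact n / b ^ (n + 1)) (at_right (ereal 0))"
      by (subst ereal_tendsto_simps) (simp add: P_0)
    show "((P n \<circ> real_of_ereal) \<longlongrightarrow> 0) (at_left \<infinity>)"
      using P_lim[of n] by (subst ereal_tendsto_simps)
  qed auto
  also have "(LBINT x=ereal 0..\<infinity>. ?g n x) = (LBINT x:{0<..}. ?g n x)"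
    by (simp add: interval_lebesgue_integral_def einterval_eq_Ici)
  also have "\<dots> = (LBINT x:{0..}. ?g n x)"
    by (rule set_integral_discrete_difference[of "{0}"]) auto
  finally show "(LBINT t:{0..}. ?g n t) = fact n / b ^ (n + 1)"
    by simp
qed

text \<open>Dominated convergence for a series whose absolute sum is bounded on \<open>A\<close>. It turns both the Laplace
  transform and the weak derivative of a series into termwise computations, so that no differentiability
  of the sum has to be shown.\<close>

lemma set_integral_sums_weighted:
  fixes w :: "real \<Rightarrow> complex" and u :: "nat \<Rightarrow> real \<Rightarrow> complex"
  assumes w: "set_integrable lborel A w"
    and u: "\<And>k. u k \<in> borel_measurable borel"
    and summ: "\<And>t. t \<in> A \<Longrightarrow> summable (\<lambda>k. norm (u k t))"
    and bound: "\<And>t. t \<in> A \<Longrightarrow> (\<Sum>k. norm (u k t)) \<le> B"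
  shows "(\<lambda>k. LBINT t:A. w t * u k t) sums (LBINT t:A. w t * (\<Sum>k. u k t))"
proof -
  let ?w = "\<lambda>t. indicator A t *\<^sub>R w t"
  have w': "integrable lborel ?w"
    using w by (simp add: set_integrable_def)
  hence [measurable]: "?w \<in> borel_measurable borel"
    by (simp add: integrable_iff_bounded)
  note [measurable] = u
  have part: "(\<Sum>k\<in>I. norm (u k t)) \<le> B" if "t \<in> A" "finite I" for t I
    using sum_le_suminf[OF summ that(2)] bound that by (force intro: order_trans)
  have wB: "integrable lborel (\<lambda>t. norm (?w t) * B)"
    using w' by (intro integrable_mult_left integrable_norm)
  have int: "integrable lborel (\<lambda>t. ?w t * u k t)" for k
  proof (rule Bochner_Integration.integrable_bound[OF wB])
    show "AE t in lborel. norm (?w t * u k t) \<le> norm (norm (?w t) * B)"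
    proof (intro AE_I2)
      fix t
      show "norm (?w t * u k t) \<le> norm (norm (?w t) * B)"
        using part[of t "{k}"] by (cases "t \<in> A") (auto simp: norm_mult abs_mult intro!: mult_left_mono)
    qed
  qed measurable
  have "(\<lambda>n. LINT t|lborel. ?w t * (\<Sum>k<n. u k t)) \<longlonglongrightarrow> (LINT t|lborel. ?w t * (\<Sum>k. u k t))"
  proof (rule integral_dominated_convergence[where w = "\<lambda>t. norm (?w t) * B"])
    show "AE t in lborel. (\<lambda>n. ?w t * (\<Sum>k<n. u k t)) \<longlonglongrightarrow> ?w t * (\<Sum>k. u k t)"
    proof (intro AE_I2)
      fix t
      show "(\<lambda>n. ?w t * (\<Sum>k<n. u k t)) \<longlonglongrightarrow> ?w t * (\<Sum>k. u k t)"
        using summable_LIMSEQ[OF summable_norm_cancel[OF summ[of t]]]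
        by (cases "t \<in> A") (auto intro!: tendsto_intros)
    qed
    show "AE t in lborel. norm (?w t * (\<Sum>k<n. u k t)) \<le> norm (?w t) * B" for n
    proof (intro AE_I2)
      fix t
      show "norm (?w t * (\<Sum>k<n. u k t)) \<le> norm (?w t) * B"
        using part[of t "{..<n}"] norm_sum[of "\<lambda>k. u k t" "{..<n}"]
        by (cases "t \<in> A") (auto simp: norm_mult intro!: mult_left_mono)
    qed
  qed (use wB in \<open>measurable\<close>)
  also have "(\<lambda>n. LINT t|lborel. ?w t * (\<Sum>k<n. u k t)) = (\<lambda>n. \<Sum>k<n. LINT t|lborel. ?w t * u k t)"
    unfolding sum_distrib_left by (rule ext, rule Bochner_Integration.integral_sum, rule int)
  finally show ?thesis
    by (simp add: sums_def set_lebesgue_integral_def)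
qed

section \<open>Weak derivatives tested against compactly supported functions\<close>

text \<open>The support interval is enlarged here so that the test function and its derivative vanish at both
  endpoints; integration by parts then has no boundary terms.\<close>

lemma test_function_bounds:
  assumes "test_function \<phi>"
  obtains a b where "0 < a" "a \<le> b"
    "\<And>t. (\<phi> has_real_derivative deriv \<phi> t) (at t)" "continuous_on UNIV (deriv \<phi>)"
    "\<And>t. t \<le> a \<or> b \<le> t \<Longrightarrow> \<phi> t = 0" "\<And>t. t \<le> a \<or> b \<le> t \<Longrightarrow> deriv \<phi> t = 0"
proof -
  from assms obtain a b where a: "0 < a" and supp: "\<And>t. \<phi> t \<noteq> 0 \<Longrightarrow> t \<in> {a..b}"
    and diff: "\<And>n t. (deriv ^^ n) \<phi> field_differentiable at t"
    unfolding test_function_def by blast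
  have d0: "(\<phi> has_real_derivative deriv \<phi> t) (at t)" for t
    using diff[of 0 t] by (simp add: DERIV_deriv_iff_field_differentiable)
  have cont: "continuous_on UNIV (deriv \<phi>)"
    using diff[of 1]
    by (auto intro!: continuous_at_imp_continuous_on field_differentiable_imp_continuous_at)
  have zero: "deriv \<phi> t = 0" if "open S" "t \<in> S" "\<And>u. u \<in> S \<Longrightarrow> \<phi> u = 0" for t S
  proof -
    have "((\<lambda>_. 0) has_real_derivative deriv \<phi> t) (at t)"
      by (rule has_field_derivative_transform_within_open[OF d0 that])
    thus ?thesis
      using DERIV_unique DERIV_const by blast
  qed
  show ?thesis
  proof (rule that[of "a / 2" "max a b + 1"])
    fix t assume t: "t \<le> a / 2 \<or> max a b + 1 \<le> t"
    with a have "t \<notin> {a..b}"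
      by auto
    with supp[of t] show "\<phi> t = 0"
      by blast
    have "t \<in> {..<a} \<union> {b<..}"
      using t a by auto
    moreover have "\<phi> u = 0" if "u \<in> {..<a} \<union> {b<..}" for u
    proof -
      have "u \<notin> {a..b}"
        using that by auto
      with supp[of u] show ?thesis
        by blast
    qed
    ultimately show "deriv \<phi> t = 0"
      by (intro zero[of "{..<a} \<union> {b<..}"]) auto
  qed (use a d0 cont in auto)
qed

lemma weak_derivative_of_C1:
  assumes test: "test_function \<phi>"
    and h: "\<And>t. (h has_vector_derivative h' t) (at t)" and h': "continuous_on UNIV h'"
  shows "(LBINT t:{0<..}. complex_of_real (deriv \<phi> t) * h t) =
         - (LBINT t:{0<..}. complex_of_real (\<phi> t) * h' t)"
proof -
  obtain a b where ab: "0 < a" "a \<le> b"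
    and d: "\<And>t. (\<phi> has_real_derivative deriv \<phi> t) (at t)" and d_cont: "continuous_on UNIV (deriv \<phi>)"
    and z: "\<And>t. t \<le> a \<or> b \<le> t \<Longrightarrow> \<phi> t = 0" "\<And>t. t \<le> a \<or> b \<le> t \<Longrightarrow> deriv \<phi> t = 0"
    using test_function_bounds[OF test] by metis
  have restrict: "(LBINT t:{0<..}. complex_of_real (p t) * q t) = (LBINT t:{a..b}. complex_of_real (p t) * q t)"
    if p: "\<And>t. t \<le> a \<or> b \<le> t \<Longrightarrow> p t = 0" for p q
    unfolding set_lebesgue_integral_def
  proof (intro Bochner_Integration.integral_cong refl)
    show "indicator {0<..} t *\<^sub>R (complex_of_real (p t) * q t) = indicator {a..b} t *\<^sub>R (complex_of_real (p t) * q t)" for t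
      using p[of t] ab(1) by (cases "a < t \<and> t < b") (auto simp: indicator_def)
  qed
  have \<phi>_cont: "continuous_on UNIV \<phi>"
    using d by (auto intro!: continuous_at_imp_continuous_on DERIV_isCont)
  have h_cont: "continuous_on UNIV h"
    using h by (auto intro!: continuous_at_imp_continuous_on has_vector_derivative_continuous)
  note cont = continuous_on_subset[OF \<phi>_cont subset_UNIV] continuous_on_subset[OF h_cont subset_UNIV]
    continuous_on_subset[OF h' subset_UNIV] continuous_on_subset[OF d_cont subset_UNIV]
  have "(LBINT t:{a..b}. of_real (\<phi> t) * h' t + of_real (deriv \<phi> t) * h t)
       = of_real (\<phi> b) * h b - of_real (\<phi> a) * h a"
    unfolding set_lebesgue_integral_def
  proof (rule integral_FTC_Icc[OF ab(2)])
    show "((\<lambda>t. of_real (\<phi> t) * h t) has_vector_derivative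
        of_real (\<phi> t) * h' t + of_real (deriv \<phi> t) * h t) (at t within {a..b})" for t
      by (rule has_vector_derivative_at_within, intro has_vector_derivative_mult has_vector_derivative_of_real d h)
  qed (intro continuous_intros cont)
  moreover have "(LBINT t:{a..b}. of_real (\<phi> t) * h' t + of_real (deriv \<phi> t) * h t) =
     (LBINT t:{a..b}. of_real (\<phi> t) * h' t) + (LBINT t:{a..b}. of_real (deriv \<phi> t) * h t)"
    by (intro set_integral_add borel_integrable_atLeastAtMost' continuous_intros cont)
  ultimately show ?thesis
    using z ab by (simp add: restrict eq_neg_iff_add_eq_0 add.commute)
qed

lemma test_function_set_integrable:
  assumes "test_function \<phi>"
  shows "set_integrable lborel {0<..} (\<lambda>t. complex_of_real (\<phi> t))"
    and "set_integrable lborel {0<..} (\<lambda>t. complex_of_real (deriv \<phi> t))"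
proof -
  obtain a b where ab: "0 < a" "a \<le> b"
    and d: "\<And>t. (\<phi> has_real_derivative deriv \<phi> t) (at t)" and d_cont: "continuous_on UNIV (deriv \<phi>)"
    and z: "\<And>t. t \<le> a \<or> b \<le> t \<Longrightarrow> \<phi> t = 0" "\<And>t. t \<le> a \<or> b \<le> t \<Longrightarrow> deriv \<phi> t = 0"
    using test_function_bounds[OF assms] by metis
  have *: "set_integrable lborel {0<..} (\<lambda>t. complex_of_real (p t))"
    if p: "\<And>t. t \<le> a \<or> b \<le> t \<Longrightarrow> p t = 0" "continuous_on UNIV p" for p
  proof -
    have "set_integrable lborel {a..b} (\<lambda>t. complex_of_real (p t))"
      by (auto intro!: borel_integrable_atLeastAtMost' continuous_intros continuous_on_subset[OF that(2)])
    also have "?this \<longleftrightarrow> ?thesis"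
      unfolding set_integrable_def
    proof (intro Bochner_Integration.integrable_cong refl)
      show "indicator {a..b} t *\<^sub>R complex_of_real (p t) = indicator {0<..} t *\<^sub>R complex_of_real (p t)" for t
        using p(1)[of t] ab(1) by (cases "a < t \<and> t < b") (auto simp: indicator_def)
    qed
    finally show ?thesis .
  qed
  have "continuous_on UNIV \<phi>"
    using d by (auto intro!: continuous_at_imp_continuous_on DERIV_isCont)
  thus "set_integrable lborel {0<..} (\<lambda>t. complex_of_real (\<phi> t))"
    and "set_integrable lborel {0<..} (\<lambda>t. complex_of_real (deriv \<phi> t))"
    using * z d_cont by blast+
qed

section \<open>Pulse trains\<close>

text \<open>The \<open>k\<close>-th pulse decays at rate \<open>k + 1\<close>, has degree \<open>n k\<close> and peaks at time \<open>n k / (k + 1)\<close> with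
  height \<open>1 / s k\<close>. Consecutive peak times differ by a factor of at least \<open>4\<close>, so that at any time at most
  one pulse is within a factor \<open>2\<close> of its peak. The rates grow so that the exponential loss in
  \<open>norm_pulse_laplace_near_peak\<close> becomes optimal in the limit; their growth is what makes a single function
  serve all \<open>\<gamma> > 1\<close>.\<close>

locale pulse_train =
  fixes n :: "nat \<Rightarrow> nat" and s :: "nat \<Rightarrow> real"
  assumes n_ge: "k + 2 \<le> n k"
    and s_ge: "8 ^ (k + 1) \<le> s k"
    and peak_gap: "i < j \<Longrightarrow> 4 * (real (n i) / real (Suc i)) \<le> real (n j) / real (Suc j)"
begin

abbreviation peak :: "nat \<Rightarrow> real" where
  "peak k \<equiv> real (n k) / real (Suc k)"

text \<open>The frequency is placed above \<open>s k\<close> by twice the decay rate. Points \<open>z\<close> whose imaginary part is closer to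
  it than this then have imaginary part above \<open>s k\<close>, where monotonicity of \<open>M\<close> and \<open>K\<close> helps, and for all
  other \<open>z\<close> the distance to the pole is at least twice the decay rate.\<close>

definition freq :: "nat \<Rightarrow> real" where
  "freq k = s k + 2 * real (Suc k)"

definition rate :: "nat \<Rightarrow> complex" where
  "rate k = Complex (real (Suc k)) (- freq k)"

text \<open>The constant that gives the envelope \<open>t ^ n * exp (- a * t)\<close> the maximum \<open>1 / s k\<close>; see \<open>bump_power\<close>.\<close>

definition amp :: "nat \<Rightarrow> real" where
  "amp k = (real (Suc k) * exp 1 / n k) ^ n k / s k"

definition pulse :: "nat \<Rightarrow> real \<Rightarrow> complex" where
  "pulse k t = of_real (amp k) * (of_real t ^ n k * exp (- rate k * of_real t))"

definition pulse_deriv :: "nat \<Rightarrow> real \<Rightarrow> complex" where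
  "pulse_deriv k t = of_real (amp k) *
     ((of_nat (n k) * of_real t ^ (n k - 1) - rate k * of_real t ^ n k) * exp (- rate k * of_real t))"

definition pulse_laplace :: "nat \<Rightarrow> complex \<Rightarrow> complex" where
  "pulse_laplace k z = of_real (amp k) * (fact (n k) / (z + rate k) ^ (n k + 1))"

definition train :: "real \<Rightarrow> complex" where
  "train t = (\<Sum>k. pulse k t)"

definition train_deriv :: "real \<Rightarrow> complex" where
  "train_deriv t = (\<Sum>k. pulse_deriv k t)"

definition train_laplace :: "complex \<Rightarrow> complex" where
  "train_laplace z = (\<Sum>k. pulse_laplace k z)"

lemma n_pos: "0 < n k"
  using n_ge[of k] by simp

lemma s_ge_rate: "real (Suc k) \<le> s k"
proof -
  have "Suc k < 8 ^ Suc k"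
    by (rule power_gt_expt) simp
  hence "real (Suc k) < 8 ^ (k + 1)"
    by (metis Suc_eq_plus1 of_nat_less_iff of_nat_numeral of_nat_power)
  thus ?thesis
    using s_ge[of k] by simp
qed

lemma s_pos: "0 < s k"
  using s_ge_rate[of k] by (simp add: order_less_le_trans)

lemma inverse_s_le: "1 / s k \<le> (1 / 8) ^ (k + 1)"
  using s_ge[of k] s_pos[of k] by (simp add: field_simps)

lemma summable_inverse_s: "summable (\<lambda>k. 1 / s k)"
proof (rule summable_comparison_test')
  show "summable (\<lambda>k. (1 / 8 :: real) ^ (k + 1))"
    by (intro summable_ignore_initial_segment summable_geometric) auto
  show "norm (1 / s k) \<le> (1 / 8) ^ (k + 1)" for k
    using inverse_s_le[of k] s_pos[of k] by simp
qed

lemma amp_nonneg: "0 \<le> amp k"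
  using s_pos[of k] by (simp add: amp_def)

lemma norm_pulse:
  assumes "0 \<le> t"
  shows "norm (pulse k t) = bump (t / peak k) ^ n k / s k"
proof -
  have e: "norm (exp (- rate k * of_real t)) = exp (- real (Suc k) * t)"
    by (simp add: rate_def algebra_simps)
  have "norm (pulse k t) = amp k * (t ^ n k * exp (- real (Suc k) * t))"
    unfolding pulse_def norm_mult norm_power e using assms amp_nonneg[of k] by simp
  also have "\<dots> = (real (Suc k) * exp 1 / n k) ^ n k * (t ^ n k * exp (- real (Suc k) * t)) / s k"
    by (simp add: amp_def)
  also have "\<dots> = bump (real (Suc k) * t / n k) ^ n k / s k"
    by (subst bump_power[OF n_pos]) simp
  also have "real (Suc k) * t / n k = t / peak k"
    by simp
  finally show ?thesis .
qed

lemma norm_pulse_le: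
  assumes "0 \<le> t"
  shows "norm (pulse k t) \<le> 1 / s k"
  unfolding norm_pulse[OF assms] using s_pos[of k] assms
  by (intro divide_right_mono power_le_one bump_le_1 bump_nonneg) auto

text \<open>Differentiation costs a factor of the size of the frequency, which is at most \<open>3 * s k\<close>; the
  height \<open>1 / s k\<close> of the pulse pays for it.\<close>

lemma norm_pulse_deriv_le:
  assumes t: "0 \<le> t"
  shows "norm (pulse_deriv k t) \<le> 7 * bump (t / peak k) ^ (n k - 1)"
proof -
  define c where "c = real (Suc k)"
  define u where "u = c * t / n k"
  define A where "A = (c * exp 1 / n k) ^ n k"
  have c: "0 < c" "c \<le> s k" and u: "0 \<le> u"
    using t s_ge_rate[of k] by (simp_all add: c_def u_def)
  have b: "0 \<le> bump u" "bump u \<le> 1"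
    using u by (simp_all add: bump_nonneg bump_le_1)
  have rate: "norm (rate k) \<le> 3 * c + s k"
    using cmod_le[of "rate k"] c s_pos[of k] by (simp add: rate_def freq_def c_def)
  have "norm (pulse_deriv k t) \<le> A / s k * ((n k * t ^ (n k - 1) + norm (rate k) * t ^ n k) * exp (- c * t))"
  proof -
    let ?p = "of_nat (n k) * of_real t ^ (n k - 1) - rate k * of_real t ^ n k"
    have p: "norm ?p \<le> n k * t ^ (n k - 1) + norm (rate k) * t ^ n k"
      by (rule order_trans[OF norm_triangle_ineq4]) (use t in \<open>simp add: norm_mult norm_power\<close>)
    have e: "norm (exp (- rate k * of_real t)) = exp (- c * t)"
      by (simp add: rate_def c_def algebra_simps)
    have "norm (pulse_deriv k t) = amp k * (norm ?p * exp (- c * t))"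
      unfolding pulse_deriv_def norm_mult e using amp_nonneg[of k] by simp
    also have "\<dots> \<le> amp k * ((n k * t ^ (n k - 1) + norm (rate k) * t ^ n k) * exp (- c * t))"
      by (intro mult_left_mono mult_right_mono p amp_nonneg) auto
    finally show ?thesis
      by (simp add: amp_def A_def c_def)
  qed
  also have "\<dots> = (A * (n k * t ^ (n k - 1) * exp (- c * t)) + norm (rate k) * (A * (t ^ n k * exp (- c * t)))) / s k"
    by (simp add: algebra_simps add_divide_distrib)
  also have "\<dots> = (c * exp (1 - u) * bump u ^ (n k - 1) + norm (rate k) * bump u ^ n k) / s k"
    unfolding A_def u_def bump_power[OF n_pos] bump_power_pred[OF n_pos] ..
  also have "\<dots> \<le> (c * 3 * bump u ^ (n k - 1) + (3 * c + s k) * bump u ^ (n k - 1)) / s k"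
  proof (intro divide_right_mono add_mono mult_mono mult_left_mono)
    have "exp (1 - u) \<le> exp 1"
      using u by simp
    thus "exp (1 - u) \<le> 3"
      using exp_le by linarith
    show "bump u ^ n k \<le> bump u ^ (n k - 1)"
      using b by (intro power_decreasing) auto
  qed (use b c rate s_pos[of k] in \<open>auto\<close>)
  also have "\<dots> = (6 * c + s k) / s k * bump u ^ (n k - 1)"
    by (simp add: algebra_simps add_divide_distrib)
  also have "\<dots> \<le> 7 * bump u ^ (n k - 1)"
    using b c s_pos[of k] by (intro mult_right_mono) (auto simp: field_simps)
  also have "u = t / peak k"
    by (simp add: u_def c_def)
  finally show ?thesis .
qed

lemma all_but_one_off_peak:
  assumes "0 \<le> t"
  obtains k0 where "\<And>k. k \<noteq> k0 \<Longrightarrow> bump (t / peak k) \<le> 5 / 6"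
proof -
  define act where "act k \<longleftrightarrow> peak k < 2 * t \<and> t < 2 * peak k" for k
  have pk: "0 < peak k" for k
    using n_pos[of k] by simp
  have uniq: "\<not> (act i \<and> act j)" if "i < j" for i j
    using peak_gap[OF that] by (auto simp: act_def)
  have far: "bump (t / peak k) \<le> 5 / 6" if "\<not> act k" for k
  proof (rule bump_far)
    show "0 \<le> t / peak k" "2 * (t / peak k) \<le> 1 \<or> 2 \<le> t / peak k"
      using that assms pk[of k] by (auto simp: act_def divide_simps mult_ac not_less)
  qed
  show ?thesis
  proof (cases "\<exists>k. act k")
    case True
    then obtain k0 where "act k0" ..
    hence "\<not> act k" if "k \<noteq> k0" for k
      using uniq[of k k0] uniq[of k0 k] that by (cases "k < k0") auto
    thus ?thesis
      using far that[of k0] by blast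
  qed (use far that[of 0] in blast)
qed

text \<open>At any time all pulses but one are off their peaks and contribute at most \<open>(5 / 6) ^ k\<close>, which uses
  \<open>n k - 1 \<ge> k\<close>; the exceptional one contributes at most \<open>1\<close>. The bound is \<open>1 + 1 / (1 - 5 / 6)\<close>.\<close>

lemma suminf_bump_le:
  assumes t: "0 \<le> t"
  shows "summable (\<lambda>k. bump (t / peak k) ^ (n k - 1))"
    and "(\<Sum>k. bump (t / peak k) ^ (n k - 1)) \<le> 7"
proof -
  obtain k0 where k0: "\<And>k. k \<noteq> k0 \<Longrightarrow> bump (t / peak k) \<le> 5 / 6"
    using all_but_one_off_peak[OF t] by blast
  let ?e = "\<lambda>k. (if k = k0 then 1 else 0) + (5 / 6 :: real) ^ k"
  have b: "0 \<le> bump (t / peak k)" for k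
    using t by (intro bump_nonneg) auto
  have le: "bump (t / peak k) ^ (n k - 1) \<le> ?e k" for k
  proof (cases "k = k0")
    case True
    have "bump (t / peak k) ^ (n k - 1) \<le> 1"
      using b by (intro power_le_one bump_le_1)
    thus ?thesis
      using True by (simp add: add_increasing2)
  next
    case False
    have "bump (t / peak k) ^ (n k - 1) \<le> (5 / 6) ^ (n k - 1)"
      using k0[OF False] b by (intro power_mono)
    also have "\<dots> \<le> (5 / 6) ^ k"
      using n_ge[of k] by (intro power_decreasing) auto
    finally show ?thesis
      using False by simp
  qed
  have e: "?e sums (1 + 1 / (1 - 5 / 6))"
    using sums_single[of k0 "\<lambda>_. 1 :: real"] by (intro sums_add geometric_sums) auto
  show "summable (\<lambda>k. bump (t / peak k) ^ (n k - 1))"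
    by (rule summable_comparison_test'[OF sums_summable[OF e]]) (use b le in simp)
  from suminf_le[OF le this sums_summable[OF e]]
  show "(\<Sum>k. bump (t / peak k) ^ (n k - 1)) \<le> 7"
    using sums_unique[OF e] by simp
qed

lemma has_vector_derivative_pulse: "(pulse k has_vector_derivative pulse_deriv k t) (at t)"
  unfolding pulse_def[abs_def] pulse_deriv_def
  by (intro has_vector_derivative_mult_right has_vector_derivative_power_mult_exp)

lemma continuous_pulse: "continuous_on A (pulse k)" "continuous_on A (pulse_deriv k)"
  unfolding pulse_def[abs_def] pulse_deriv_def[abs_def] by (intro continuous_intros)+

lemma measurable_pulse: "pulse k \<in> borel_measurable borel" "pulse_deriv k \<in> borel_measurable borel"
  by (intro borel_measurable_continuous_onI continuous_pulse)+

lemma summable_norm_pulse: "0 \<le> t \<Longrightarrow> summable (\<lambda>k. norm (pulse k t))"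
  by (rule summable_comparison_test'[OF summable_inverse_s]) (use norm_pulse_le in simp)

lemma suminf_norm_pulse_le: "0 \<le> t \<Longrightarrow> (\<Sum>k. norm (pulse k t)) \<le> (\<Sum>k. 1 / s k)"
  by (intro suminf_le norm_pulse_le summable_norm_pulse summable_inverse_s)

lemma summable_norm_pulse_deriv: "0 \<le> t \<Longrightarrow> summable (\<lambda>k. norm (pulse_deriv k t))"
  by (rule summable_comparison_test'[OF summable_mult[OF suminf_bump_le(1), of t 7]])
     (use norm_pulse_deriv_le in auto)

lemma suminf_norm_pulse_deriv_le:
  assumes "0 \<le> t"
  shows "(\<Sum>k. norm (pulse_deriv k t)) \<le> 49"
proof -
  have "(\<Sum>k. norm (pulse_deriv k t)) \<le> (\<Sum>k. 7 * bump (t / peak k) ^ (n k - 1))"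
    using assms by (intro suminf_le norm_pulse_deriv_le summable_norm_pulse_deriv summable_mult suminf_bump_le)
  also have "\<dots> = 7 * (\<Sum>k. bump (t / peak k) ^ (n k - 1))"
    by (rule suminf_mult[OF suminf_bump_le(1)[OF assms]])
  finally show ?thesis
    using suminf_bump_le(2)[OF assms] by simp
qed

lemma continuous_train: "continuous_on {0..} train"
proof -
  have "uniform_limit {0..} (\<lambda>m t. \<Sum>k<m. pulse k t) (\<lambda>t. \<Sum>k. pulse k t) sequentially"
    by (rule Weierstrass_m_test[OF _ summable_inverse_s]) (use norm_pulse_le in auto)
  hence "continuous_on {0..} (\<lambda>t. \<Sum>k. pulse k t)"
    by (rule uniform_limit_theorem[rotated]) (auto intro!: always_eventually continuous_on_sum continuous_pulse)
  thus ?thesis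
    by (simp add: train_def[abs_def])
qed

lemma locally_integrable_train: "locally_integrable train"
  unfolding locally_integrable_def
  by (auto intro!: borel_integrable_atLeastAtMost' continuous_on_subset[OF continuous_train])

lemma L_infinity_train_deriv: "L_infinity train_deriv"
  unfolding L_infinity_def
proof (intro conjI exI AE_I2 impI)
  note [measurable] = measurable_pulse(2)
  have "train_deriv \<in> borel_measurable borel"
    unfolding train_deriv_def[abs_def] by measurable
  thus "set_borel_measurable lborel {0..} train_deriv"
    unfolding set_borel_measurable_def by measurable
  fix t :: real assume "0 \<le> t"
  thus "cmod (train_deriv t) \<le> 49"
    unfolding train_deriv_def
    using summable_norm[OF summable_norm_pulse_deriv[of t]] suminf_norm_pulse_deriv_le[of t] by simp
qed

lemma has_weak_derivative_train: "has_weak_derivative train train_deriv"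
  unfolding has_weak_derivative_def
proof (intro allI impI)
  fix \<phi> assume \<phi>: "test_function \<phi>"
  have "(\<lambda>k. LBINT t:{0<..}. complex_of_real (deriv \<phi> t) * pulse k t) sums
        (LBINT t:{0<..}. complex_of_real (deriv \<phi> t) * train t)"
    unfolding train_def
    by (rule set_integral_sums_weighted[where B = "\<Sum>k. 1 / s k"])
       (use test_function_set_integrable[OF \<phi>] measurable_pulse summable_norm_pulse suminf_norm_pulse_le
        in auto)
  moreover have "(\<lambda>k. - (LBINT t:{0<..}. complex_of_real (\<phi> t) * pulse_deriv k t)) sums
        - (LBINT t:{0<..}. complex_of_real (\<phi> t) * train_deriv t)"
    unfolding train_deriv_def
    by (rule sums_minus, rule set_integral_sums_weighted[where B = 49])
       (use test_function_set_integrable[OF \<phi>] measurable_pulse summable_norm_pulse_deriv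
          suminf_norm_pulse_deriv_le in auto)
  moreover have "(LBINT t:{0<..}. complex_of_real (deriv \<phi> t) * pulse k t) =
      - (LBINT t:{0<..}. complex_of_real (\<phi> t) * pulse_deriv k t)" for k
    by (rule weak_derivative_of_C1[OF \<phi> has_vector_derivative_pulse continuous_pulse(2)])
  ultimately show "(LBINT t:{0<..}. complex_of_real (deriv \<phi> t) * train t) =
      - (LBINT t:{0<..}. complex_of_real (\<phi> t) * train_deriv t)"
    using sums_unique2 by simp
qed

lemma laplace_transform_train:
  assumes z: "0 < Re z"
  shows "train_laplace z = laplace_transform train z"
proof -
  have "(\<lambda>k. LBINT t:{0..}. exp (- z * complex_of_real t) * pulse k t) sums laplace_transform train z"
    unfolding laplace_transform_def train_def
  proof (rule set_integral_sums_weighted[where B = "\<Sum>k. 1 / s k"])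
    show "set_integrable lborel {0..} (\<lambda>t. exp (- z * complex_of_real t))"
      using laplace_monomial(1)[OF z, of 0] by simp
  qed (use measurable_pulse summable_norm_pulse suminf_norm_pulse_le in auto)
  moreover have "(LBINT t:{0..}. exp (- z * complex_of_real t) * pulse k t) = pulse_laplace k z" for k
  proof -
    have "exp (- z * complex_of_real t) * pulse k t =
        of_real (amp k) * (of_real t ^ n k * exp (- (z + rate k) * of_real t))" for t
    proof -
      have "exp (- (z + rate k) * of_real t) = exp (- z * of_real t) * exp (- rate k * of_real t)"
        by (simp add: ring_distribs flip: exp_add)
      thus ?thesis
        by (simp only: pulse_def mult_ac)
    qed
    moreover have "0 < Re (z + rate k)"
      using z by (simp add: rate_def)
    ultimately show ?thesis
      by (simp only: pulse_laplace_def set_integral_mult_right laplace_monomial(2))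
  qed
  ultimately show ?thesis
    by (simp add: train_laplace_def sums_iff)
qed

section \<open>The Laplace transform of a pulse train\<close>

lemma amp_fact_le: "amp k * fact (n k) \<le> exp 1 * sqrt (n k) * real (Suc k) ^ n k / s k"
proof -
  have "amp k * fact (n k) \<le> amp k * (exp 1 * sqrt (n k) * (real (n k) / exp 1) ^ n k)"
    by (intro mult_left_mono fact_le_sqrt_mult_exp n_pos amp_nonneg)
  also have "\<dots> = exp 1 * sqrt (n k) * ((real (Suc k) * exp 1 / n k) * (real (n k) / exp 1)) ^ n k / s k"
    unfolding power_mult_distrib by (simp add: amp_def)
  also have "(real (Suc k) * exp 1 / n k) * (real (n k) / exp 1) = real (Suc k)"
    using n_pos[of k] by simp
  finally show ?thesis .
qed

lemma norm_pulse_laplace_le: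
  assumes "0 < r" "r \<le> norm (z + rate k)"
  shows "norm (pulse_laplace k z) \<le> exp 1 * sqrt (n k) / s k * ((real (Suc k) / r) ^ n k / r)"
proof -
  have "norm (pulse_laplace k z) = amp k * fact (n k) / norm (z + rate k) ^ (n k + 1)"
    using amp_nonneg[of k] by (simp add: pulse_laplace_def norm_mult norm_divide norm_power)
  also have "\<dots> \<le> (exp 1 * sqrt (n k) * real (Suc k) ^ n k / s k) / r ^ (n k + 1)"
    using assms s_pos[of k] by (intro frac_le amp_fact_le power_mono) auto
  also have "\<dots> = exp 1 * sqrt (n k) / s k * ((real (Suc k) / r) ^ n k / r)"
    by (simp add: power_divide)
  finally show ?thesis .
qed

text \<open>At distance at least twice the decay rate from the pole, the \<open>n\<close>-th power gains a factor \<open>2 ^ n\<close> and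
  beats the Stirling factor \<open>sqrt n\<close>, wherever the real part of \<open>z\<close> is.\<close>

lemma norm_pulse_laplace_off_peak:
  assumes "2 * real (Suc k) \<le> \<bar>Im z - freq k\<bar>"
  shows "norm (pulse_laplace k z) \<le> exp 1 / s k"
proof -
  define c where "c = real (Suc k)"
  have c: "1 \<le> c"
    by (simp add: c_def)
  have "\<bar>Im z - freq k\<bar> \<le> norm (z + rate k)"
    using abs_Im_le_cmod[of "z + rate k"] by (simp add: rate_def)
  hence "norm (pulse_laplace k z) \<le> exp 1 * sqrt (n k) / s k * ((c / (2 * c)) ^ n k / (2 * c))"
    unfolding c_def using assms by (intro norm_pulse_laplace_le) auto
  also have "\<dots> = exp 1 / s k * (sqrt (n k) / 2 ^ n k / (2 * c))"
    using c by (simp add: power_divide)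
  also have "\<dots> \<le> exp 1 / s k * 1"
  proof (intro mult_left_mono)
    have "sqrt (n k) \<le> n k"
      using n_pos[of k] by (simp add: real_le_lsqrt self_le_power)
    also have "\<dots> \<le> 2 ^ n k"
      by (rule of_nat_less_two_power[THEN less_imp_le])
    finally have "sqrt (n k) / 2 ^ n k \<le> 1"
      by simp
    hence "sqrt (n k) / 2 ^ n k / (2 * c) \<le> 1 / 1"
      using c by (intro frac_le) auto
    thus "sqrt (n k) / 2 ^ n k / (2 * c) \<le> 1"
      by simp
  qed (use s_pos[of k] in auto)
  finally show ?thesis by simp
qed

text \<open>Near the height of the pole only the real part helps: with \<open>a = real (Suc k)\<close> the distance is at least
  \<open>a - 1 / m\<close>, and \<open>(a / (a - 1 / m)) ^ n \<le> exp (n / (a * m - 1))\<close>. For \<open>m\<close> the value of \<open>M\<close> at \<open>s k\<close>, the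
  exponent is the peak time divided by \<open>m\<close>, up to a factor that tends to \<open>1\<close> as \<open>a\<close> grows.\<close>

lemma norm_pulse_laplace_near_peak:
  assumes m: "2 \<le> m" and z: "- (1 / m) \<le> Re z"
  shows "norm (pulse_laplace k z) \<le>
     2 * exp 1 * sqrt (n k / real (Suc k)) / s k * exp (n k / (real (Suc k) * m - 1))"
proof -
  define c where "c = real (Suc k)"
  define r where "r = c - 1 / m"
  have c: "1 \<le> c"
    by (simp add: c_def)
  have m': "1 / m \<le> 1 / 2"
    using m by simp
  have cm: "2 \<le> c * m"
    using mult_mono[of 1 c 2 m] c m by simp
  have r: "c / 2 \<le> r" "0 < r"
    using c m' by (simp_all add: r_def)
  have "c + Re z \<le> norm (z + rate k)"
    using complex_Re_le_cmod[of "z + rate k"] by (simp add: rate_def c_def)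
  hence "norm (pulse_laplace k z) \<le> exp 1 * sqrt (n k) / s k * ((c / r) ^ n k / r)"
    unfolding c_def[symmetric] using z r
    by (intro norm_pulse_laplace_le[of r z k, folded c_def]) (auto simp: r_def)
  also have "\<dots> \<le> exp 1 * sqrt (n k) / s k * (exp (n k / (c * m - 1)) / (c / 2))"
  proof (intro mult_left_mono frac_le)
    have "c / r = 1 + 1 / (c * m - 1)"
      using m c cm by (simp add: r_def divide_simps)
    also have "\<dots> \<le> exp (1 / (c * m - 1))"
      by (rule exp_ge_add_one_self)
    finally have "(c / r) ^ n k \<le> exp (1 / (c * m - 1)) ^ n k"
      using c r by (intro power_mono) auto
    also have "\<dots> = exp (n k / (c * m - 1))"
      by (simp flip: exp_of_nat_mult)
    finally show "(c / r) ^ n k \<le> exp (n k / (c * m - 1))" .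
  qed (use r c s_pos[of k] in auto)
  also have "\<dots> = 2 * exp 1 * (sqrt (n k) / c) / s k * exp (n k / (c * m - 1))"
    using c by (simp add: mult_ac)
  also have "\<dots> \<le> 2 * exp 1 * sqrt (n k / c) / s k * exp (n k / (c * m - 1))"
  proof -
    have "sqrt c \<le> c"
      using c by (simp add: real_le_lsqrt self_le_power)
    hence "sqrt (n k) / c \<le> sqrt (n k / c)"
      using c by (simp add: real_sqrt_divide frac_le)
    thus ?thesis
      using s_pos[of k] by (intro mult_right_mono divide_right_mono mult_left_mono) auto
  qed
  finally show ?thesis
    by (simp only: c_def)
qed

text \<open>All poles have real part at most \<open>- 1\<close>, and their imaginary parts escape to infinity. Near a given point all
  but finitely many pulses are therefore off peak and dominated by a multiple of \<open>1 / s k\<close>.\<close>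

lemma train_laplace_analytic: "train_laplace analytic_on {z. - 1 < Re z}"
proof -
  let ?S = "{z. - 1 < Re z}"
  have S: "open ?S"
    by (rule open_halfspace_Re_gt)
  have "\<exists>g g'. \<forall>x \<in> ?S. ((\<lambda>k. pulse_laplace k x) sums g x) \<and> ((\<lambda>k. deriv (pulse_laplace k) x) sums g' x) \<and> (g has_field_derivative g' x) (at x)"
  proof (rule series_and_derivative_comparison_local[OF S])
    fix k x assume "x \<in> ?S"
    hence "x + rate k \<noteq> 0"
      by (auto simp: complex_eq_iff rate_def)
    hence "pulse_laplace k field_differentiable at x"
      unfolding pulse_laplace_def[abs_def] by (intro derivative_intros) auto
    thus "(pulse_laplace k has_field_derivative deriv (pulse_laplace k) x) (at x)"
      by (rule field_differentiable_derivI)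
  next
    fix x assume "x \<in> ?S"
    have "\<forall>\<^sub>F k in sequentially. norm x + 1 \<le> real k"
      by real_asymp
    hence "\<forall>\<^sub>F k in sequentially. \<forall>y\<in>ball x 1 \<inter> ?S. norm (pulse_laplace k y) \<le> exp 1 * (1 / s k)"
    proof eventually_elim
      case (elim k)
      show ?case
      proof
        fix y assume "y \<in> ball x 1 \<inter> ?S"
        hence "norm y \<le> norm x + 1"
          using norm_triangle_ineq2[of y x] by (simp add: dist_norm norm_minus_commute)
        hence "Im y \<le> s k"
          using elim s_ge_rate[of k] abs_Im_le_cmod[of y] by simp
        thus "norm (pulse_laplace k y) \<le> exp 1 * (1 / s k)"
          using norm_pulse_laplace_off_peak[of k y] by (simp add: freq_def)
      qed
    qed
    thus "\<exists>d h. 0 < d \<and> summable h \<and> (\<forall>\<^sub>F k in sequentially. \<forall>y\<in>ball x d \<inter> ?S. norm (pulse_laplace k y) \<le> h k)"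
      using summable_mult[OF summable_inverse_s, of "exp 1"]
      by (intro exI[of _ 1] exI[of _ "\<lambda>k. exp 1 * (1 / s k)"]) simp
  qed
  then obtain g g' where g: "\<And>x. x \<in> ?S \<Longrightarrow> (\<lambda>k. pulse_laplace k x) sums g x"
      "\<And>x. x \<in> ?S \<Longrightarrow> (g has_field_derivative g' x) (at x)"
    by blast
  have "g holomorphic_on ?S"
    using g(2) S by (subst holomorphic_on_open) auto
  also have "?this \<longleftrightarrow> train_laplace holomorphic_on ?S"
    using g(1) by (intro holomorphic_cong) (auto simp: train_laplace_def sums_iff)
  finally show ?thesis
    using S by (simp add: analytic_on_open)
qed

text \<open>The sum of \<open>(1 / 8) ^ (j + 1)\<close> is \<open>1 / 7\<close>, so the other pulses cannot cancel the one that peaks.\<close>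

lemma norm_train_at_peak_ge:
  assumes other: "\<And>j. j \<noteq> k \<Longrightarrow> s k * norm (pulse j (peak k)) \<le> (1 / 8) ^ (j + 1)"
  shows "1 / 2 \<le> s k * norm (train (peak k))"
proof -
  have pk: "0 < peak k"
    using n_pos[of k] by simp
  have summ: "summable (\<lambda>j. norm (pulse j (peak k)))"
    using pk by (intro summable_norm_pulse) simp
  \<comment> \<open>the train without its peaking pulse\<close>
  define r where "r j = (if j = k then 0 else pulse j (peak k))" for j
  have r_summ: "summable (\<lambda>j. norm (r j))"
    by (rule summable_comparison_test'[OF summ]) (simp add: r_def)
  have "(\<lambda>j. (if j = k then pulse j (peak k) else 0) + r j) sums (pulse k (peak k) + (\<Sum>j. r j))"
    by (intro sums_add sums_single summable_sums summable_norm_cancel[OF r_summ])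
  moreover have "(\<lambda>j. (if j = k then pulse j (peak k) else 0) + r j) = (\<lambda>j. pulse j (peak k))"
    by (auto simp: r_def)
  ultimately have "train (peak k) = pulse k (peak k) + (\<Sum>j. r j)"
    by (simp add: train_def sums_iff)
  moreover have "norm (pulse k (peak k)) = 1 / s k"
    using pk by (subst norm_pulse) (auto simp: bump_def)
  moreover have "s k * norm (\<Sum>j. r j) \<le> 1 / 2"
  proof -
    have "s k * norm (\<Sum>j. r j) \<le> s k * (\<Sum>j. norm (r j))"
      using s_pos[of k] summable_norm[OF r_summ] by simp
    also have "\<dots> = (\<Sum>j. s k * norm (r j))"
      by (rule suminf_mult[OF r_summ, symmetric])
    also have "\<dots> \<le> (\<Sum>j. (1 / 8) ^ (j + 1))"
      using other
      by (intro suminf_le summable_mult r_summ summable_ignore_initial_segment summable_geometric)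
         (auto simp: r_def)
    also have "\<dots> = 1 / 7"
      using suminf_geometric[of "1 / 8 :: real"] suminf_mult[OF summable_geometric[of "1 / 8 :: real"], of "1 / 8"]
      by simp
    finally show ?thesis by simp
  qed
  ultimately show ?thesis
    using s_pos[of k] norm_diff_ineq[of "pulse k (peak k)" "\<Sum>j. r j"]
      mult_left_mono[of "1 / s k - norm (\<Sum>j. r j)" "norm (train (peak k))" "s k"]
    by (simp add: right_diff_distrib)
qed

text \<open>Calibrating the peak times by \<open>M_log M K (s k) = c * peak k\<close> turns the near-peak bound into powers of \<open>M\<close>
  and \<open>K\<close> at \<open>s k\<close>: with \<open>x = ln (K (s k)) / c\<close> the peak time is \<open>M (s k) * x\<close>, its square root gives
  \<open>M powr (1/2)\<close>, and the exponential is \<open>exp (\<theta> * x)\<close>, that is \<open>K (s k) powr (\<theta> / c)\<close>, with \<open>\<theta>\<close> tending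
  to \<open>1\<close>. A pulse is near its peak only when the imaginary part of \<open>z\<close> is at least \<open>s k\<close>, so \<open>M\<close> and \<open>K\<close> may be evaluated there.\<close>

lemma norm_train_laplace_le:
  assumes M_mono: "mono_on {0..} M" and M_ge: "\<And>s. 0 \<le> s \<Longrightarrow> 2 \<le> M s"
    and K_mono: "mono_on {0..} K" and K_ge: "\<And>s. 0 \<le> s \<Longrightarrow> 2 \<le> K s"
    and c: "0 < c" and calib: "\<And>k. M_log M K (s k) = c * peak k" and \<gamma>: "1 < \<gamma>"
  shows "\<exists>C>0. \<forall>z\<in>Omega M.
    norm (train_laplace z) \<le> C * M \<bar>Im z\<bar> powr (1/2) * K \<bar>Im z\<bar> powr (\<gamma> / c)"
proof -
  define x where "x k = ln (K (s k)) / c" for k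
  define \<theta> where "\<theta> k = 2 * real (Suc k) / (2 * real (Suc k) - 1)" for k
  have s0: "0 \<le> s k" for k
    using s_pos[of k] by simp
  have x0: "0 \<le> x k" for k
    using K_ge[OF s0[of k]] c by (simp add: x_def)
  have \<theta>_lim: "\<theta> \<longlonglongrightarrow> 1"
    unfolding \<theta>_def by real_asymp
  obtain B where B: "0 \<le> B" "\<And>k. sqrt (x k) * exp (\<theta> k * x k) \<le> B * exp (\<gamma> * x k)"
    using sqrt_mult_exp_sequence_bounded[of x \<theta> \<gamma>, OF x0 \<theta>_lim \<gamma>] by blast
  define A where "A = exp 1 + 2 * exp 1 * B"
  have A: "0 < A"
    using B by (simp add: A_def add_pos_nonneg)
  define S where "S = (\<Sum>k. 1 / s k)"
  have S: "0 < S"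
    unfolding S_def using s_pos by (intro suminf_pos summable_inverse_s) auto
  have "norm (train_laplace z) \<le> A * S * M \<bar>Im z\<bar> powr (1/2) * K \<bar>Im z\<bar> powr (\<gamma> / c)"
    if z: "z \<in> Omega M" for z
  proof -
    define y where "y = \<bar>Im z\<bar>"
    define R where "R = M y powr (1/2) * K y powr (\<gamma> / c)"
    have y: "2 \<le> M y" "2 \<le> K y"
      using M_ge K_ge by (simp_all add: y_def)
    have R: "1 \<le> R"
      unfolding R_def using y \<gamma> c
      by (intro mult_ge1_I ge_one_powr_ge_zero) auto
    have each: "norm (pulse_laplace k z) \<le> A * R * (1 / s k)" for k
    proof (cases "2 * real (Suc k) \<le> \<bar>Im z - freq k\<bar>")
      case True
      have "exp 1 \<le> A * R"
        using mult_mono[of "exp 1" A 1 R] A R B by (simp add: A_def)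
      thus ?thesis
        using norm_pulse_laplace_off_peak[OF True] s_pos[of k] 
          divide_right_mono[of "exp 1" "A * R" "s k"] by simp
    next
      case False
      hence le: "s k \<le> y" "Im z = y"
        using s_pos[of k] by (auto simp: freq_def y_def)
      define m where "m = M (s k)"
      have m: "2 \<le> m" "m \<le> M y"
        using M_ge[OF s0] mono_onD[OF M_mono, of "s k" y] s0[of k] le by (auto simp: m_def)
      have Ky: "K (s k) \<le> K y"
        using mono_onD[OF K_mono, of "s k" y] s0[of k] le by auto
      have "- (1 / m) \<le> - (1 / M y)"
        using m by (simp add: frac_le)
      hence zm: "- (1 / m) \<le> Re z"
        using z by (simp add: Omega_def y_def)
      have mx: "m * x k = peak k"
        using calib[of k] c by (simp add: M_log_def m_def x_def field_simps)
      have "n k / (real (Suc k) * m - 1) = real (Suc k) * m / (real (Suc k) * m - 1) * x k"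
        using mx by (simp add: field_simps)
      also have "\<dots> \<le> \<theta> k * x k"
      proof (intro mult_right_mono x0)
        have dec: "v / (v - 1) \<le> u / (u - 1)" if "1 < u" "u \<le> v" for u v :: real
          using that by (simp add: field_simps)
        have "1 < real (Suc k) * 2"
          by simp
        moreover have "real (Suc k) * 2 \<le> real (Suc k) * m"
          by (rule mult_left_mono[OF m(1)]) simp
        ultimately have "real (Suc k) * m / (real (Suc k) * m - 1) \<le> real (Suc k) * 2 / (real (Suc k) * 2 - 1)"
          by (rule dec)
        thus "real (Suc k) * m / (real (Suc k) * m - 1) \<le> \<theta> k"
          by (simp add: \<theta>_def mult.commute)
      qed
      finally have ex: "exp (n k / (real (Suc k) * m - 1)) \<le> exp (\<theta> k * x k)"
        by simp
      have "norm (pulse_laplace k z) \<le> 2 * exp 1 * sqrt (peak k) / s k * exp (n k / (real (Suc k) * m - 1))"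
        by (rule norm_pulse_laplace_near_peak[OF m(1) zm])
      also have "\<dots> \<le> 2 * exp 1 * sqrt (peak k) / s k * exp (\<theta> k * x k)"
        using s_pos[of k] by (intro mult_left_mono ex) auto
      also have "\<dots> = 2 * exp 1 / s k * sqrt m * (sqrt (x k) * exp (\<theta> k * x k))"
        unfolding mx[symmetric] real_sqrt_mult by simp
      also have "\<dots> \<le> 2 * exp 1 / s k * sqrt m * (B * exp (\<gamma> * x k))"
        using s_pos[of k] m by (intro mult_left_mono B) auto
      also have "exp (\<gamma> * x k) = K (s k) powr (\<gamma> / c)"
        using K_ge[OF s0[of k]] by (simp add: powr_def x_def)
      also have "2 * exp 1 / s k * sqrt m * (B * (K (s k) powr (\<gamma> / c))) \<le>
          2 * exp 1 / s k * (M y powr (1/2)) * (B * (K y powr (\<gamma> / c)))"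
        using s_pos[of k] m Ky K_ge[OF s0[of k]] \<gamma> c y B
        by (intro mult_mono mult_left_mono powr_mono2) (auto simp: powr_half_sqrt)
      also have "\<dots> = (2 * exp 1 * B) * R * (1 / s k)"
        by (simp add: R_def)
      also have "\<dots> \<le> A * R * (1 / s k)"
        using R s_pos[of k] by (intro mult_right_mono) (auto simp: A_def)
      finally show ?thesis .
    qed
    have summ: "summable (\<lambda>k. A * R * (1 / s k))"
      by (intro summable_mult summable_inverse_s)
    have summ': "summable (\<lambda>k. norm (pulse_laplace k z))"
      by (rule summable_comparison_test'[OF summ]) (use each in simp)
    have "norm (train_laplace z) \<le> (\<Sum>k. norm (pulse_laplace k z))"
      unfolding train_laplace_def by (rule summable_norm[OF summ'])
    also have "\<dots> \<le> (\<Sum>k. A * R * (1 / s k))"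
      by (intro suminf_le each summ summ')
    also have "\<dots> = A * R * S"
      unfolding S_def by (rule suminf_mult[OF summable_inverse_s])
    finally show ?thesis
      by (simp add: R_def y_def mult_ac)
  qed
  thus ?thesis
    using A S by (intro exI[of _ "A * S"]) simp
qed

end

section \<open>Choosing the peaks\<close>

text \<open>Preimages of \<open>c * x\<close> under \<open>L\<close> grow subexponentially in \<open>x\<close>, because \<open>L\<close> dominates every multiple of the
  logarithm. Any choice of preimages will do, since the supremum only makes the weight in the limit
  superior larger.\<close>

lemma right_inverse_of_slowly_dominated:
  fixes L :: "real \<Rightarrow> real"
  assumes cont: "continuous_on {0..} L" and mono: "mono_on {0..} L"
    and dom: "filterlim (\<lambda>s. L s / ln (2 + s)) at_top at_top" and c: "0 < c"
  obtains S where "\<forall>\<^sub>F x in at_top. 0 \<le> S x \<and> L (S x) = c * x"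
    and "\<forall>\<^sub>F x in at_top. S x \<le> Sup {s. 0 \<le> s \<and> L s = c * x}"
    and "filterlim S at_top at_top"
    and "\<And>\<delta>. 0 < \<delta> \<Longrightarrow> \<forall>\<^sub>F x in at_top. S x \<le> exp (\<delta> * x)"
proof -
  have L_ge: "\<forall>\<^sub>F s in at_top. q * ln (2 + s) \<le> L s" for q
  proof -
    have "\<forall>\<^sub>F s in at_top. q \<le> L s / ln (2 + s)"
      using dom by (simp add: filterlim_at_top)
    with eventually_ge_at_top[of 0] show ?thesis
      by eventually_elim (simp add: pos_le_divide_eq)
  qed
  have L_lim: "filterlim L at_top at_top"
  proof (rule filterlim_at_top_mono)
    show "filterlim (\<lambda>s::real. ln (2 + s)) at_top at_top"
      by real_asymp
    show "\<forall>\<^sub>F s in at_top. ln (2 + s) \<le> L s"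
      using L_ge[of 1] by simp
  qed
  \<comment> \<open>eventually, the intermediate value theorem provides such a point\<close>
  define S where "S x = (SOME s. 0 \<le> s \<and> L s = c * x)" for x
  have large: "\<forall>\<^sub>F x in at_top. r \<le> c * x" for r
    using c by real_asymp
  have S: "\<forall>\<^sub>F x in at_top. 0 \<le> S x \<and> L (S x) = c * x"
    using large[of "L 0"]
  proof eventually_elim
    case (elim x)
    obtain b where b: "0 \<le> b" "c * x \<le> L b"
      using eventually_conj[OF eventually_ge_at_top[of 0] filterlim_at_top[THEN iffD1, OF L_lim, rule_format, of "c * x"]]
      by (auto dest!: eventually_happens)
    have "\<exists>s\<ge>0. s \<le> b \<and> L s = c * x"
      using elim b by (intro IVT' continuous_on_subset[OF cont]) auto
    thus ?case
      unfolding S_def by (metis (mono_tags, lifting) someI_ex)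
  qed
  have S_lim: "filterlim S at_top at_top"
    unfolding filterlim_at_top
  proof
    fix r
    show "\<forall>\<^sub>F x in at_top. r \<le> S x"
      using S large[of "L (max r 0) + 1"]
    proof eventually_elim
      case (elim x)
      show ?case
      proof (rule ccontr)
        assume "\<not> r \<le> S x"
        hence "L (S x) \<le> L (max r 0)"
          using elim by (intro mono_onD[OF mono]) auto
        thus False
          using elim by simp
      qed
    qed
  qed
  show ?thesis
  proof (rule that[OF S _ S_lim])
    show "\<forall>\<^sub>F x in at_top. S x \<le> Sup {s. 0 \<le> s \<and> L s = c * x}"
      using S
    proof eventually_elim
      case (elim x)
      obtain b where b: "\<And>s. b \<le> s \<Longrightarrow> c * x + 1 \<le> L s"
        using filterlim_at_top[THEN iffD1, OF L_lim, rule_format, of "c * x + 1"]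
        by (auto simp: eventually_at_top_linorder)
      show ?case
      proof (rule cSup_upper)
        show "S x \<in> {s. 0 \<le> s \<and> L s = c * x}"
          using elim by simp
        show "bdd_above {s. 0 \<le> s \<and> L s = c * x}"
        proof (rule bdd_aboveI)
          fix s assume "s \<in> {s. 0 \<le> s \<and> L s = c * x}"
          thus "s \<le> b"
            using b[of s] by (cases "s \<le> b") auto
        qed
      qed
    qed
    fix \<delta> :: real assume \<delta>: "0 < \<delta>"
    have "\<forall>\<^sub>F x in at_top. c / \<delta> * ln (2 + S x) \<le> L (S x)"
      by (rule eventually_compose_filterlim[OF L_ge S_lim])
    with S show "\<forall>\<^sub>F x in at_top. S x \<le> exp (\<delta> * x)"
    proof eventually_elim
      case (elim x)
      have "ln (2 + S x) \<le> \<delta> * x"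
        using elim c \<delta> by (simp add: field_simps)
      hence "exp (ln (2 + S x)) \<le> exp (\<delta> * x)"
        by simp
      thus ?case
        using elim by simp
    qed
  qed
qed

text \<open>A pulse decays exponentially after its peak, hence faster than a subexponential weight can grow.\<close>

lemma eventually_mult_bump_power_le:
  assumes nonneg: "\<forall>\<^sub>F x in at_top. 0 \<le> S x"
    and growth: "\<And>\<delta>. 0 < \<delta> \<Longrightarrow> \<forall>\<^sub>F x in at_top. S x \<le> exp (\<delta> * x)"
    and p: "0 < p" and m: "0 < m" and \<epsilon>: "0 < \<epsilon>"
  shows "\<forall>\<^sub>F x in at_top. S x * bump (x / p) ^ m \<le> \<epsilon>"
proof -
  define v where "v x = x / p * exp (1 - x / (2 * p))" for x
  have "(v \<longlongrightarrow> 0) at_top"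
    unfolding v_def[abs_def] using p by real_asymp
  hence "\<forall>\<^sub>F x in at_top. v x < min \<epsilon> 1"
    using \<epsilon> by (intro order_tendstoD) auto
  \<comment> \<open>half of the exponential decay rate \<open>m / p\<close> of the bump is given away to \<open>S\<close>\<close>
  moreover have "\<forall>\<^sub>F x in at_top. S x \<le> exp (m / (2 * p) * x)"
    using p m by (intro growth) auto
  ultimately show ?thesis
    using nonneg eventually_ge_at_top[of 0]
  proof eventually_elim
    case (elim x)
    have v0: "0 \<le> v x"
      using p elim by (simp add: v_def)
    have "S x * bump (x / p) ^ m \<le> exp (m / (2 * p) * x) * bump (x / p) ^ m"
      using elim p by (intro mult_right_mono zero_le_power bump_nonneg) auto
    also have "\<dots> = (exp (x / (2 * p)) * bump (x / p)) ^ m"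
      by (simp add: power_mult_distrib flip: exp_of_nat_mult)
    also have "exp (x / (2 * p)) * bump (x / p) = x / p * (exp (x / (2 * p)) * exp (1 - x / p))"
      by (simp add: bump_def)
    also have "\<dots> = v x"
      using p by (simp add: v_def field_simps flip: exp_add)
    also have "v x ^ m \<le> v x ^ 1"
      using v0 elim m by (intro power_decreasing) auto
    finally show ?case
      using elim by simp
  qed
qed

text \<open>Every condition on the \<open>k\<close>-th peak, given the earlier ones, holds for all sufficiently late peak times. So the
  degrees can be chosen one after the other. Seen from the peak of the \<open>k\<close>-th pulse, an earlier pulse has decayed by the
  previous lemma, and a later pulse is small because its height is at most \<open>1 / s j\<close> with \<open>s j\<close> much larger than
  \<open>s k\<close>.\<close>

lemma exists_pulse_train:
  assumes S: "filterlim S at_top at_top"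
    and growth: "\<And>\<delta>. 0 < \<delta> \<Longrightarrow> \<forall>\<^sub>F x in at_top. S x \<le> exp (\<delta> * x)"
    and Q: "\<forall>\<^sub>F x in at_top. Q x"
  obtains n s where "pulse_train n s"
    and "\<And>k. s k = S (real (n k) / real (Suc k))"
    and "\<And>k. Q (real (n k) / real (Suc k))"
    and "\<And>k. real k \<le> real (n k) / real (Suc k)"
    and "\<And>j k. j \<noteq> k \<Longrightarrow>
      s k * (bump ((real (n k) / real (Suc k)) / (real (n j) / real (Suc j))) ^ n j / s j) \<le> (1 / 8) ^ (j + 1)"
proof -
  define X where "X k r = real r / real (Suc k)" for k r :: nat
  define P where "P f k r \<longleftrightarrow> k + 2 \<le> r \<and> 8 ^ (k + 1) \<le> S (X k r) \<and> Q (X k r) \<and> real k \<le> X k r \<and>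
    (\<forall>j\<in>{..<k}. 4 * X j (f j) \<le> X k r \<and> 8 ^ (k + 1) * S (X j (f j)) \<le> S (X k r) \<and>
       S (X k r) * bump (X k r / X j (f j)) ^ f j \<le> (1 / 8) ^ (j + 1))" for f k r
  have X_lim: "filterlim (X k) at_top at_top" for k
    unfolding X_def[abs_def] by real_asymp
  have S_ge: "\<forall>\<^sub>F x in at_top. r \<le> S x" for r
    using S by (simp add: filterlim_at_top)
  have "\<exists>n. \<forall>k. P n k (n k)"
  proof (rule dependent_wellorder_choice)
    show "P f k r = P g k r" if "\<And>j. j < k \<Longrightarrow> f j = g j" for r f g k
      unfolding P_def using that by auto
  next
    fix k f assume f: "\<And>j. j < k \<Longrightarrow> P f j (f j)"
    have "\<forall>\<^sub>F x in at_top. 8 ^ (k + 1) \<le> S x \<and> Q x \<and> real k \<le> x \<and>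
      (\<forall>j\<in>{..<k}. 4 * X j (f j) \<le> x \<and> 8 ^ (k + 1) * S (X j (f j)) \<le> S x \<and>
         S x * bump (x / X j (f j)) ^ f j \<le> (1 / 8) ^ (j + 1))"
    proof (intro eventually_conj eventually_ball_finite ballI S_ge Q eventually_ge_at_top)
      fix j assume "j \<in> {..<k}"
      hence "0 < f j"
        using f[of j] by (simp add: P_def)
      thus "\<forall>\<^sub>F x in at_top. S x * bump (x / X j (f j)) ^ f j \<le> (1 / 8) ^ (j + 1)"
        by (intro eventually_mult_bump_power_le S_ge growth) (auto simp: X_def)
    qed auto
    hence "\<forall>\<^sub>F r in at_top. P f k r"
      unfolding P_def
      by (intro eventually_conj[OF eventually_ge_at_top]) (rule eventually_compose_filterlim[OF _ X_lim])
    thus "\<exists>r. P f k r"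
      by (auto dest: eventually_happens)
  qed
  then obtain n where n: "\<And>k. P n k (n k)"
    by blast
  define s where "s k = S (X k (n k))" for k
  have s_ge: "8 ^ (k + 1) \<le> s k" for k
    using n[of k] by (simp add: P_def s_def)
  have s_pos: "0 < s k" for k
    by (rule less_le_trans[OF _ s_ge]) simp
  have s_ge_1: "1 \<le> s k" for k
    by (rule order_trans[OF _ s_ge]) (rule one_le_power, simp)
  have earlier: "4 * X j (n j) \<le> X k (n k)" "8 ^ (k + 1) * s j \<le> s k"
      "s k * bump (X k (n k) / X j (n j)) ^ n j \<le> (1 / 8) ^ (j + 1)" if "j < k" for j k
    using n[of k] that unfolding P_def s_def by auto
  show ?thesis
  proof (rule that[of n s])
    show "pulse_train n s"
    proof
      show "k + 2 \<le> n k" for k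
        using n[of k] by (simp add: P_def)
    qed (use s_ge earlier(1) in \<open>auto simp: X_def\<close>)
    show "s k * (bump ((real (n k) / real (Suc k)) / (real (n j) / real (Suc j))) ^ n j / s j) \<le> (1 / 8) ^ (j + 1)"
      if "j \<noteq> k" for j k
    proof -
      let ?b = "bump (X k (n k) / X j (n j)) ^ n j"
      have b: "0 \<le> ?b" "?b \<le> 1"
      proof -
        have "0 \<le> X k (n k) / X j (n j)"
          by (simp add: X_def)
        thus "0 \<le> ?b" "?b \<le> 1"
          by (simp_all add: bump_nonneg bump_le_1 power_le_one)
      qed
      have "s k * (?b / s j) \<le> (1 / 8) ^ (j + 1)"
      proof (cases "j < k")
        case True
        have "?b / s j \<le> ?b / 1"
          using b s_ge_1[of j] by (intro divide_left_mono) auto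
        hence "s k * (?b / s j) \<le> s k * ?b"
          using s_pos[of k] by (intro mult_left_mono) auto
        from this earlier(3)[OF True] show ?thesis
          by (rule order_trans)
      next
        case False
        with that have "k < j" by simp
        have "s k * (?b / s j) \<le> s k * (1 / s j)"
          using b s_pos[of k] s_pos[of j] by (intro mult_left_mono divide_right_mono) auto
        also have "\<dots> \<le> 1 / 8 ^ (j + 1)"
          using earlier(2)[OF \<open>k < j\<close>] s_pos[of j] by (simp add: field_simps)
        finally show ?thesis
          by (simp add: power_divide)
      qed
      thus ?thesis
        by (simp only: X_def)
    qed
  qed (use n in \<open>auto simp: P_def s_def X_def\<close>)
qed

section \<open>The extremal function\<close>

text \<open>One function has the bound for all \<open>\<gamma> > 1\<close> at once, and the constant may depend on \<open>\<gamma>\<close>.\<close>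

lemma extremal_function_exists:
  fixes M K :: "real \<Rightarrow> real"
  assumes M_cont: "continuous_on {0..} M" and M_mono: "mono_on {0..} M"
    and M_ge: "\<And>s. 0 \<le> s \<Longrightarrow> 2 \<le> M s"
    and K_cont: "continuous_on {0..} K" and K_mono: "mono_on {0..} K"
    and K_ge: "\<And>s. 0 \<le> s \<Longrightarrow> 2 \<le> K s"
    and lim: "filterlim (\<lambda>s. M_log M K s / ln (2 + s)) at_top at_top"
    and c: "0 < c"
  shows "\<exists>f F. extremal_function M K c f F \<and>
    (\<forall>\<gamma>>1. \<exists>C>0. \<forall>z\<in>Omega M.
       cmod (F z) \<le> C * M \<bar>Im z\<bar> powr (1/2) * K \<bar>Im z\<bar> powr (\<gamma> / c))"
proof -
  have L_cont: "continuous_on {0..} (M_log M K)"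
    unfolding M_log_def[abs_def] using K_ge
    by (intro continuous_intros M_cont K_cont) force
  have L_mono: "mono_on {0..} (M_log M K)"
  proof (rule mono_onI)
    fix a b :: real assume ab: "a \<in> {0..}" "b \<in> {0..}" "a \<le> b"
    show "M_log M K a \<le> M_log M K b"
      unfolding M_log_def
      using mono_onD[OF M_mono ab] mono_onD[OF K_mono ab] M_ge[of a] M_ge[of b] K_ge[of a] K_ge[of b] ab
      by (intro mult_mono) auto
  qed
  obtain S where S: "\<forall>\<^sub>F x in at_top. 0 \<le> S x \<and> M_log M K (S x) = c * x"
    "\<forall>\<^sub>F x in at_top. S x \<le> M_log_inv M K (c * x)" "filterlim S at_top at_top"
    "\<And>\<delta>. 0 < \<delta> \<Longrightarrow> \<forall>\<^sub>F x in at_top. S x \<le> exp (\<delta> * x)"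
    using right_inverse_of_slowly_dominated[OF L_cont L_mono lim c, folded M_log_inv_def] by blast
  have branch: "\<forall>\<^sub>F x in at_top. M_log M K (S x) = c * x \<and> S x \<le> M_log_inv M K (c * x)"
    using S(1,2) by eventually_elim simp
  obtain n s where train: "pulse_train n s"
    and s: "\<And>k. s k = S (real (n k) / real (Suc k))"
    and Q: "\<And>k. M_log M K (S (real (n k) / real (Suc k))) = c * (real (n k) / real (Suc k)) \<and>
       S (real (n k) / real (Suc k)) \<le> M_log_inv M K (c * (real (n k) / real (Suc k)))"
    and large: "\<And>k. real k \<le> real (n k) / real (Suc k)"
    and other: "\<And>j k. j \<noteq> k \<Longrightarrow>
      s k * (bump ((real (n k) / real (Suc k)) / (real (n j) / real (Suc j))) ^ n j / s j) \<le> (1 / 8) ^ (j + 1)"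
    using exists_pulse_train[OF S(3,4) branch] by blast
  interpret pulse_train n s
    by (rule train)
  have bound: "\<exists>C>0. \<forall>z\<in>Omega M.
     cmod (train_laplace z) \<le> C * M \<bar>Im z\<bar> powr (1/2) * K \<bar>Im z\<bar> powr (\<gamma> / c)" if "1 < \<gamma>" for \<gamma>
    using Q by (intro norm_train_laplace_le M_mono M_ge K_mono K_ge c that) (auto simp: s)
  have sub: "Omega M \<union> closed_right_half_plane \<subseteq> {z. - 1 < Re z}"
  proof -
    have "- 1 < Re z" if "z \<in> Omega M" for z
    proof -
      have "1 / M \<bar>Im z\<bar> \<le> 1 / 2"
        using M_ge[of "\<bar>Im z\<bar>"] by (intro divide_left_mono) auto
      thus ?thesis
        using that by (simp add: Omega_def)
    qed
    thus ?thesis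
      by (auto simp: closed_right_half_plane_def)
  qed
  have peak_large: "1 / 2 \<le> M_log_inv M K (c * peak k) * cmod (train (peak k))" for k
  proof -
    have "1 / 2 \<le> s k * norm (train (peak k))"
      using other by (intro norm_train_at_peak_ge) (simp add: norm_pulse)
    also have "\<dots> \<le> M_log_inv M K (c * peak k) * norm (train (peak k))"
      using Q[of k] by (intro mult_right_mono) (auto simp: s)
    finally show ?thesis .
  qed
  have "ereal (1 / 2) \<le> Limsup at_top (\<lambda>t. ereal (M_log_inv M K (c * t) * cmod (train t)))"
  proof (rule Limsup_greatest)
    fix P :: "real \<Rightarrow> bool" assume "eventually P at_top"
    then obtain t0 where t0: "\<And>t. t0 \<le> t \<Longrightarrow> P t"
      by (auto simp: eventually_at_top_linorder)
    obtain k where "t0 \<le> real k"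
      using real_arch_simple by blast
    hence "P (peak k)"
      using large[of k] by (intro t0) simp
    thus "ereal (1 / 2) \<le> (SUP t\<in>Collect P. ereal (M_log_inv M K (c * t) * cmod (train t)))"
      using peak_large[of k] by (intro SUP_upper2[of "peak k"]) auto
  qed
  moreover have "(0 :: ereal) < ereal (1 / 2)"
    by simp
  ultimately have "0 < Limsup at_top (\<lambda>t. ereal (M_log_inv M K (c * t) * cmod (train t)))"
    by (rule less_le_trans[rotated])
  hence "extremal_function M K c train train_laplace"
    unfolding extremal_function_def
    using locally_integrable_train continuous_train has_weak_derivative_train L_infinity_train_deriv
      analytic_on_subset[OF train_laplace_analytic sub] laplace_transform_train by blast
  thus ?thesis
    using bound by blast
qed

theorem theorem4p1:
  fixes M K :: "real \<Rightarrow> real"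
  assumes M_cont: "continuous_on {0..} M" and M_mono: "mono_on {0..} M"
    and M_ge: "\<And>s. 0 \<le> s \<Longrightarrow> 2 \<le> M s"
    and K_cont: "continuous_on {0..} K" and K_mono: "mono_on {0..} K"
    and K_ge: "\<And>s. 0 \<le> s \<Longrightarrow> 2 \<le> K s"
    and i_lim: "filterlim (\<lambda>s. M_log M K s / ln (2 + s)) at_top at_top"
    and i_K: "\<exists>\<epsilon>>0. \<exists>s0>0. \<forall>s\<ge>s0. K s \<ge> s powr \<epsilon>"
  shows
    "((\<exists>N :: real \<Rightarrow> real. mono_on {0..} N \<and> (\<forall>s\<ge>0. 1 \<le> N s) \<and>
         (\<exists>s0>0. \<forall>s\<ge>s0. \<forall>s'\<ge>0. M (s + s') \<le> N s' * M s))
      \<longrightarrow>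
      (\<exists>\<gamma>\<ge>0. \<forall>c1>0. \<exists>f F. extremal_function M K c1 f F \<and>
         (\<exists>C>0. \<forall>z\<in>Omega M.
            cmod (F z) \<le> C * M \<bar>Im z\<bar> powr (1/2) * K \<bar>Im z\<bar> powr (\<gamma> / c1))))
     \<and>
     (\<forall>\<gamma>0\<ge>1.
        (\<forall>s1>0. \<exists>s0>0. \<forall>s\<ge>s0. \<forall>s'. 0 \<le> s' \<and> s' \<le> s1 \<longrightarrow> M (s + s') \<le> \<gamma>0 * M s)
        \<longrightarrow>
        (\<forall>\<gamma>>\<gamma>0. \<forall>c1>0. \<exists>f F. extremal_function M K c1 f F \<and>
           (\<exists>C>0. \<forall>z\<in>Omega M.
              cmod (F z) \<le> C * M \<bar>Im z\<bar> powr (1/2) * K \<bar>Im z\<bar> powr (\<gamma> / c1)))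
        \<and>
        (\<not> bdd_above (M ` {0..}) \<longrightarrow>
           (\<forall>c1>0. \<exists>f F. extremal_function M K c1 f F \<and>
              (\<forall>\<gamma>>\<gamma>0. \<exists>C>0. \<forall>z\<in>Omega M.
                 cmod (F z) \<le> C * M \<bar>Im z\<bar> powr (1/2) * K \<bar>Im z\<bar> powr (\<gamma> / c1)))))"
proof -
  define bounded_by where "bounded_by F \<gamma> c \<longleftrightarrow> (\<exists>C>0. \<forall>z\<in>Omega M.
     cmod (F z) \<le> C * M \<bar>Im z\<bar> powr (1/2) * K \<bar>Im z\<bar> powr (\<gamma> / c))" for F \<gamma> c
  have ex: "\<exists>f F. extremal_function M K c f F \<and> (\<forall>\<gamma>>1. bounded_by F \<gamma> c)" if "0 < c" for c
    unfolding bounded_by_def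
    by (rule extremal_function_exists) (use assms that in simp_all)
  have uniform: "\<exists>f F. extremal_function M K c f F \<and> (\<forall>\<gamma>>\<gamma>0. bounded_by F \<gamma> c)"
    if "0 < c" "1 \<le> \<gamma>0" for c \<gamma>0
    using ex[OF that(1)] that(2) by (meson le_less_trans)
  have single: "\<exists>f F. extremal_function M K c f F \<and> bounded_by F \<gamma> c" if "0 < c" "1 < \<gamma>" for c \<gamma>
    using ex[OF that(1)] that(2) by blast
  show ?thesis
    unfolding bounded_by_def[symmetric]
  proof (intro conjI impI allI)
    \<comment> \<open>any exponent above \<open>1\<close> serves all \<open>c1\<close>\<close>
    show "\<exists>\<gamma>\<ge>0. \<forall>c1>0. \<exists>f F. extremal_function M K c1 f F \<and> bounded_by F \<gamma> c1"
      using single by (intro exI[of _ 2]) auto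
  qed (use uniform single in auto)
qed

end
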